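(* Let $\{x^k\}$ be generated by the RNBPG method, and let $F^*$ and $X^*$ be the optimal value and the set of optimal solutions of $\min_x F(x)$, respectively. Suppose that $f$ and $\Psi$ are convex functions and that $F$ is uniformly continuous in $$\mathcal{S}=\left\{x: F(x)\le F(x^0)+\max\left\{\frac{n}{\sigma}\left|L_f-\underline\theta\right|,1\right\}(F(x^0)-F^* )\right\}.$$ Assume that there exists a subsequence (infinite index set) $\mathcal{K}$ such that $\{\mathbf{E}_{\xi_{k-1}}[\mathrm{dist}(x^k,X^* )]\}_{k\in\mathcal{K}}$ is bounded. Then: (i) $\lim_{k\to\infty}\mathbf{E}_{\xi_{k-1}}[F(x^k)]=F^*$. (ii) For any $\epsilon>0$ and $\rho\in(0,1)$, there exists $K$ such that for all $k\ge K$, $$\mathbf{P}\left(F(x^k)-F^*\le\epsilon\right)\ge 1-\rho.$$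
   Context: **Problem.** $x\in\mathbb{R}^N$ is partitioned into blocks $x=(x_1,\dots,x_n)$, $x_i\in\mathbb{R}^{N_i}$. Consider $\min_{x\in\mathbb{R}^N}\{F(x):=f(x)+\Psi(x)\}$ with $\Psi(x)=\sum_{i=1}^n\Psi_i(x_i)$. The function $f:\mathbb{R}^N\to\mathbb{R}$ is differentiable, and $\Psi_i:\mathbb{R}^{N_i}\to\mathbb{R}\cup\{+\infty\}$. $\|\cdot\|$ is the Euclidean norm, $\nabla_i f$ is the partial gradient with respect to $x_i$, and there are constants $L_i>0$ with $\|\nabla_i f(x+h)-\nabla_i f(x)\|\le L_i\|h\|$ for all $x\in\mathbb{R}^N$, all $i$, and all $h=(h_1,\dots,h_n)$ with $h_j=0$ for all $j\ne i$. Put $L_f=\sum_i L_i$. The set $X^*$ of optimal solutions is nonempty; $\mathrm{dom}(F)=\{x:F(x)<+\infty\}$; $\mathrm{dist}(x,S)$ is the Euclidean distance from $x$ to $S$. **RNBPG method.** Choose $x^0\in\mathrm{dom}(F)$, $\eta>1$, $\sigma>0$, $0<\underline\theta\le\bar\theta$, an integer $M\ge 0$, and $0<p_i<1$ with $\sum_{i=1}^n p_i=1$. For $k=0,1,2,\dots$: 1) Set $d^k=0$. Pick $i_k=i\in\{1,\dots,n\}$ with probability $p_i$. Choose $\theta_k^0\in[\underline\theta,\bar\theta]$. 2) For $j=0,1,\dots$: let $\theta_k=\theta_k^0\eta^j$, compute the $i_k$-th block of $d^k$ (the other blocks being $0$) as $(d^k)_{i_k}=\arg\min_s\{\nabla_{i_k}f(x^k)^Ts+\frac{\theta_k}{2}\|s\|^2+\Psi_{i_k}(x^k_{i_k}+s)\}$;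 if $F(x^k+d^k)\le\max_{[k-M]^+\le i\le k}F(x^i)-\frac{\sigma}{2}\|d^k\|^2$, stop the inner loop. 3) Set $x^{k+1}=x^k+d^k$. Here $[t]^+=\max\{0,t\}$, and $\arg\min$ denotes a minimizer (assumed to exist). **Randomness.** The $i_k$ are drawn independently; $\xi_k=\{i_0,\dots,i_k\}$, and $\mathbf{E}_{\xi_k}$ is expectation with respect to $\xi_k$ ($\mathbf{E}_{\xi_{-1}}[F(x^0)]=F(x^0)$). All other choices (such as $\theta^0_k$) are determined by the realized indices, so $x^k$ is a function of $\xi_{k-1}$ and $d^k$ is a function of $\xi_k$. *)

theory Defs
  imports "HOL-Probability.Probability"
begin

text \<open>
  The partition of \<open>x \<in> R^N\<close> into blocks is given by a map \<open>blk\<close> sending each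
  coordinate to the index of its block; the number of blocks is the cardinality of the (finite)
  type of block indices. The space \<open>R^(N_i)\<close> is identified with the subspace of the vectors
  supported on block \<open>i\<close>, so that a step in block \<open>i\<close> is directly a vector \<open>d\<close> whose other
  blocks are zero, and \<open>\<Psi>\<^sub>i\<close> is only ever evaluated on that subspace.
\<close>

definition block :: "('n \<Rightarrow> 'b) \<Rightarrow> 'b \<Rightarrow> real ^ 'n \<Rightarrow> real ^ 'n" where
  "block blk i x = (\<chi> c. if blk c = i then x $ c else 0)"

definition block_space :: "('n \<Rightarrow> 'b) \<Rightarrow> 'b \<Rightarrow> (real ^ 'n) set" where
  "block_space blk i = {h. \<forall>c. blk c \<noteq> i \<longrightarrow> h $ c = 0}"

definition sepfun :: "('n \<Rightarrow> 'b::finite) \<Rightarrow> ('b \<Rightarrow> real ^ 'n \<Rightarrow> ereal) \<Rightarrow> real ^ 'n \<Rightarrow> ereal" where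
  "sepfun blk psi x = (\<Sum>i\<in>UNIV. psi i (block blk i x))"

definition composite ::
    "('n \<Rightarrow> 'b::finite) \<Rightarrow> (real ^ 'n \<Rightarrow> real) \<Rightarrow> ('b \<Rightarrow> real ^ 'n \<Rightarrow> ereal) \<Rightarrow> real ^ 'n \<Rightarrow> ereal" where
  "composite blk f psi x = ereal (f x) + sepfun blk psi x"

text \<open>
  The library's \<^const>\<open>convex_on\<close> only covers real-valued functions. Below, the convention
  \<open>0 * \<infinity> = 0\<close> of the extended reals makes the cases \<open>t = 0\<close> and \<open>t = 1\<close> trivial.
\<close>

definition convex_ereal :: "('a::real_vector \<Rightarrow> ereal) \<Rightarrow> bool" where
  "convex_ereal g \<longleftrightarrow>
     (\<forall>x y. \<forall>t\<in>{0..1}. g ((1 - t) *\<^sub>R x + t *\<^sub>R y) \<le> ereal (1 - t) * g x + ereal t * g y)"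

definition opt_value :: "('a \<Rightarrow> ereal) \<Rightarrow> ereal" where
  "opt_value F = (INF x. F x)"

definition opt_set :: "('a \<Rightarrow> ereal) \<Rightarrow> 'a set" where
  "opt_set F = {x. is_arg_min F (\<lambda>_. True) x}"

definition prox_model ::
    "('n::finite \<Rightarrow> 'b) \<Rightarrow> (real ^ 'n \<Rightarrow> real ^ 'n) \<Rightarrow> ('b \<Rightarrow> real ^ 'n \<Rightarrow> ereal) \<Rightarrow>
     'b \<Rightarrow> real ^ 'n \<Rightarrow> real \<Rightarrow> real ^ 'n \<Rightarrow> ereal" where
  "prox_model blk gradf psi i x \<theta> s =
     ereal (block blk i (gradf x) \<bullet> s + \<theta> / 2 * (norm s)\<^sup>2) + psi i (block blk i x + s)"

definition is_prox_step ::
    "('n::finite \<Rightarrow> 'b) \<Rightarrow> (real ^ 'n \<Rightarrow> real ^ 'n) \<Rightarrow> ('b \<Rightarrow> real ^ 'n \<Rightarrow> ereal) \<Rightarrow>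
     'b \<Rightarrow> real ^ 'n \<Rightarrow> real \<Rightarrow> real ^ 'n \<Rightarrow> bool" where
  "is_prox_step blk gradf psi i x \<theta> s \<longleftrightarrow>
     is_arg_min (prox_model blk gradf psi i x \<theta>) (\<lambda>s. s \<in> block_space blk i) s"

text \<open>The truncated subtraction \<open>k - m\<close> on naturals is \<open>[k - m]\<^sup>+\<close>.\<close>

definition sufficient_decrease ::
    "('a::real_normed_vector \<Rightarrow> ereal) \<Rightarrow> real \<Rightarrow> nat \<Rightarrow> (nat \<Rightarrow> 'a) \<Rightarrow> nat \<Rightarrow> 'a \<Rightarrow> bool" where
  "sufficient_decrease F \<sigma> m x k d \<longleftrightarrow>
     F (x k + d) \<le> Max ((\<lambda>l. F (x l)) ` {k - m..k}) - ereal (\<sigma> / 2 * (norm d)\<^sup>2)"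

text \<open>
  A run along the index sequence \<open>idx\<close> with initial trial parameters \<open>\<theta>0\<close>, iterates \<open>x\<close> and
  accepted steps \<open>d\<close>. In iteration \<open>k\<close> the inner loop computes the trial steps
  \<open>s 0, \<dots>, s j\<close> and stops at the first one passing the line search; the existence of the
  minimizers that are computed is part of the definition.
\<close>

definition rnbpg_run ::
    "('n::finite \<Rightarrow> 'b::finite) \<Rightarrow> (real ^ 'n \<Rightarrow> real) \<Rightarrow> (real ^ 'n \<Rightarrow> real ^ 'n) \<Rightarrow>
     ('b \<Rightarrow> real ^ 'n \<Rightarrow> ereal) \<Rightarrow> real \<Rightarrow> real \<Rightarrow> real \<Rightarrow> real \<Rightarrow> nat \<Rightarrow> real ^ 'n \<Rightarrow>
     (nat \<Rightarrow> 'b) \<Rightarrow> (nat \<Rightarrow> real) \<Rightarrow> (nat \<Rightarrow> real ^ 'n) \<Rightarrow> (nat \<Rightarrow> real ^ 'n) \<Rightarrow> bool" where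
  "rnbpg_run blk f gradf psi \<eta> \<sigma> \<theta>lo \<theta>hi m x0 idx \<theta>0 x d \<longleftrightarrow>
     x 0 = x0 \<and>
     (\<forall>k. \<theta>0 k \<in> {\<theta>lo..\<theta>hi} \<and>
          (\<exists>j s. (\<forall>l\<le>j. is_prox_step blk gradf psi (idx k) (x k) (\<theta>0 k * \<eta> ^ l) (s l)) \<and>
                 (\<forall>l<j. \<not> sufficient_decrease (composite blk f psi) \<sigma> m x k (s l)) \<and>
                 sufficient_decrease (composite blk f psi) \<sigma> m x k (s j) \<and>
                 d k = s j) \<and>
          x (Suc k) = x k + d k)"

text \<open>
  The indices \<open>idx 0, idx 1, \<dots>\<close> are independent with distribution \<open>p\<close>, every realization is a
  run, and the choices made in iteration \<open>k\<close> are determined by the indices \<open>idx 0, \<dots>, idx k\<close>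
  (hence the iterate \<open>x k\<close> by \<open>idx 0, \<dots>, idx (k - 1)\<close>). In particular, the expectation over
  these indices of a function of \<open>x k\<close> is its integral with respect to \<open>P\<close>.
\<close>

definition rnbpg_process ::
    "('n::finite \<Rightarrow> 'b::finite) \<Rightarrow> (real ^ 'n \<Rightarrow> real) \<Rightarrow> (real ^ 'n \<Rightarrow> real ^ 'n) \<Rightarrow>
     ('b \<Rightarrow> real ^ 'n \<Rightarrow> ereal) \<Rightarrow> real \<Rightarrow> real \<Rightarrow> real \<Rightarrow> real \<Rightarrow> nat \<Rightarrow> real ^ 'n \<Rightarrow>
     ('b \<Rightarrow> real) \<Rightarrow> 'w measure \<Rightarrow>
     (nat \<Rightarrow> 'w \<Rightarrow> 'b) \<Rightarrow> (nat \<Rightarrow> 'w \<Rightarrow> real) \<Rightarrow> (nat \<Rightarrow> 'w \<Rightarrow> real ^ 'n) \<Rightarrow> (nat \<Rightarrow> 'w \<Rightarrow> real ^ 'n) \<Rightarrow> bool" where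
  "rnbpg_process blk f gradf psi \<eta> \<sigma> \<theta>lo \<theta>hi m x0 p P idx \<theta>0 x d \<longleftrightarrow>
     prob_space P \<and>
     prob_space.indep_vars P (\<lambda>_. count_space UNIV) idx UNIV \<and>
     (\<forall>k i. measure P {\<omega> \<in> space P. idx k \<omega> = i} = p i) \<and>
     (\<forall>\<omega>\<in>space P. rnbpg_run blk f gradf psi \<eta> \<sigma> \<theta>lo \<theta>hi m x0
        (\<lambda>k. idx k \<omega>) (\<lambda>k. \<theta>0 k \<omega>) (\<lambda>k. x k \<omega>) (\<lambda>k. d k \<omega>)) \<and>
     (\<forall>k. \<forall>\<omega>\<in>space P. \<forall>\<omega>'\<in>space P.
        (\<forall>l\<le>k. idx l \<omega> = idx l \<omega>') \<longrightarrow> \<theta>0 k \<omega> = \<theta>0 k \<omega>' \<and> d k \<omega> = d k \<omega>')"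

end

theory Submission
  imports Defs
begin

text \<open>
  Write \<open>u\<^sub>k = F (x\<^sub>k) - F\<^sup>*\<close>. The line search makes the maximum of \<open>F\<close> over the last \<open>m + 1\<close>
  iterates a nonincreasing function of \<open>k\<close>, along every realization of the indices. Since \<open>F\<close> is
  uniformly continuous on the level set of \<open>x0\<close>, this forces \<open>u\<^sub>k\<close> to converge and the steps
  \<open>d\<^sub>k\<close> to vanish (\<open>nonmonotone_descent_converges\<close>). Residual and progress are bounded by
  multiples of \<open>F (x0) - F\<^sup>*\<close>, so by dominated convergence \<open>E u\<^sub>k\<close> converges, and the mean of the
  progress \<open>z\<^sub>k = \<bar>F (x\<^sub>k) - F (x\<^sub>k\<^sub>+\<^sub>1)\<bar> + \<parallel>d\<^sub>k\<parallel>\<^sup>2\<close> tends to \<open>0\<close>. It remains to show that the limit of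
  \<open>E u\<^sub>k\<close> is \<open>0\<close>, and for that the infinitely many \<open>k\<close> with \<open>E dist (x\<^sub>k, X\<^sup>*) \<le> R\<close> suffice.

  The link between progress and residual is convexity. Compare the accepted proximal step in block
  \<open>i\<close> with the \<open>i\<close>-th block of the competitor \<open>t (y - x\<^sub>k)\<close>, where \<open>y\<close> is an optimal point whose
  distance to \<open>x\<^sub>k\<close> is at most \<open>1 + D\<^sub>k\<close> with \<open>D\<^sub>k = dist (x\<^sub>k, X\<^sup>*)\<close>. As the accepted
  proximal parameters are at most a constant \<open>\<Theta>\<close>, this bounds a negative multiple of \<open>z\<^sub>k\<close>
  from above by a quantity \<open>Q\<^sub>i (x\<^sub>k)\<close> (\<open>prox_step_gap\<close>), and convexity of \<open>f\<close> gives
  \<open>\<Sum>\<^sub>i Q\<^sub>i (x\<^sub>k) \<le> \<Theta> / 2 * t\<^sup>2 * \<parallel>y - x\<^sub>k\<parallel>\<^sup>2 - t * u\<^sub>k\<close> (\<open>sum_gap\<close>). Only the inequality for the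
  block that was actually drawn is available on a realization. But \<open>x\<^sub>k\<close> is independent of the
  \<open>k\<close>-th index, so dividing by the probability of the drawn block turns the expectation into the sum
  over all blocks (\<open>expectation_importance_weighted\<close>).

  Only the first moment of \<open>D\<^sub>k\<close> is controlled, while the quadratic term involves its square.
  The choice \<open>t = \<tau> / (1 + D\<^sub>k)\<close> removes the square, at the price of weighting the residual:
  \<open>E [u\<^sub>k / (1 + D\<^sub>k)] \<le> \<kappa> * E z\<^sub>k / \<tau> + \<Theta> / 2 * \<tau>\<close>. The weight is undone by truncating at
  \<open>1 + D\<^sub>k = A\<close>, which costs \<open>(F (x0) - F\<^sup>*) * (1 + R) / A\<close>. Letting \<open>k\<close> tend to infinity
  along the given subsequence, then \<open>\<tau>\<close> to \<open>0\<close> and \<open>A\<close> to infinity gives the first claim; the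
  second one follows by Markov's inequality.
\<close>

section \<open>Nonmonotone descent sequences\<close>

lemma uniformly_continuous_on_restrict:
  fixes g :: "'a::metric_space \<Rightarrow> 'b::metric_space"
  assumes "uniformly_continuous_on S g" and "T \<subseteq> S"
  shows "uniformly_continuous_on T g"
  using assms unfolding uniformly_continuous_on_def by (meson subsetD)

lemma nonmonotone_max_decseq:
  fixes a :: "nat \<Rightarrow> real"
  assumes "\<And>k. a (Suc k) \<le> Max (a ` {k - m..k})"
  shows "decseq (\<lambda>k. Max (a ` {k - m..k}))"
proof (rule decseq_SucI)
  fix k
  show "Max (a ` {Suc k - m..Suc k}) \<le> Max (a ` {k - m..k})"
  proof (rule Max.boundedI)
    fix v assume "v \<in> a ` {Suc k - m..Suc k}"
    then obtain l where l: "v = a l" "l \<in> {Suc k - m..Suc k}" by auto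
    show "v \<le> Max (a ` {k - m..k})"
    proof (cases "l = Suc k")
      case True
      then show ?thesis using assms l by simp
    next
      case False
      then have "l \<in> {k - m..k}" using l by auto
      then show ?thesis using l by auto
    qed
  qed auto
qed

lemma nonmonotone_le_initial:
  fixes a :: "nat \<Rightarrow> real"
  assumes "\<And>k. a (Suc k) \<le> Max (a ` {k - m..k})"
  shows "Max (a ` {k - m..k}) \<le> a 0"
  using decseqD[OF nonmonotone_max_decseq[OF assms], of 0 k] by simp

text \<open>
  Let \<open>V\<close> be the limit of the window maxima \<open>W k\<close>. If \<open>\<phi> (x (k + 1))\<close> is not far below \<open>V\<close>, the
  descent inequality leaves no room for a long step, so by uniform continuity \<open>\<phi> (x k)\<close> is not far
  below \<open>V\<close> either. Every window contains an index with value at least \<open>V\<close>; going back from it to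
  the start of the window takes at most \<open>m\<close> such moves, whence all values are eventually close to \<open>V\<close>.
\<close>

lemma nonmonotone_descent_converges:
  fixes x :: "nat \<Rightarrow> 'a::real_normed_vector" and \<phi> :: "'a \<Rightarrow> real"
  assumes uc: "uniformly_continuous_on S \<phi>" and xS: "\<And>k. x k \<in> S" and c: "c > 0"
    and descent: "\<And>k. \<phi> (x (Suc k))
          \<le> Max ((\<lambda>l. \<phi> (x l)) ` {k - m..k}) - c * (norm (x (Suc k) - x k))\<^sup>2"
    and bound: "\<And>k. B \<le> \<phi> (x k)"
  shows "convergent (\<lambda>k. \<phi> (x k))" and "(\<lambda>k. norm (x (Suc k) - x k)) \<longlonglongrightarrow> 0"
proof -
  define a where "a k = \<phi> (x k)" for k
  define W where "W k = Max (a ` {k - m..k})" for k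
  define D where "D k = norm (x (Suc k) - x k)" for k
  have step: "a (Suc k) \<le> W k - c * (D k)\<^sup>2" for k
    using descent[of k] by (simp add: a_def W_def D_def)
  have "a (Suc k) \<le> W k" for k
    using step[of k] c by (smt (verit) mult_nonneg_nonneg zero_le_power2)
  then have dec: "decseq W"
    using nonmonotone_max_decseq[of a m] by (simp add: W_def[abs_def])
  have aW: "a k \<le> W k" for k by (auto simp: W_def)
  have "B \<le> W k" for k using aW[of k] bound[of k] by (simp add: a_def)
  then obtain V where V: "W \<longlonglongrightarrow> V" "\<And>k. V \<le> W k"
    using decseq_convergent[OF dec, of B] by blast
  \<comment> \<open>The window that ends at \<open>k + m\<close> starts exactly at \<open>k\<close>, also when \<open>k < m\<close>.\<close>
  have window: "\<exists>j\<le>m. a (k + j) \<ge> V" for k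
  proof -
    have "W (k + m) \<in> a ` {k..k + m}" unfolding W_def
      using Max_in[of "a ` {k + m - m..k + m}"] by simp
    then obtain l where "l \<in> {k..k + m}" "W (k + m) = a l" by auto
    then show ?thesis using V(2)[of "k + m"] by (intro exI[of _ "l - k"]) auto
  qed
  have pull: "\<exists>\<delta>>0. \<forall>\<^sub>F k in sequentially. a (Suc k) \<ge> V - \<delta> \<longrightarrow> a k \<ge> V - e"
    if e: "e > 0" for e
  proof -
    obtain r where r: "r > 0" "\<And>u v. u \<in> S \<Longrightarrow> v \<in> S \<Longrightarrow> dist v u < r \<Longrightarrow> dist (\<phi> v) (\<phi> u) < e / 2"
      using uc e unfolding uniformly_continuous_on_def by (meson half_gt_zero)
    \<comment> \<open>The second bound makes \<open>W k - a (Suc k)\<close> less than \<open>c * r\<^sup>2\<close>, which forces \<open>D k < r\<close>.\<close>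
    define \<delta> where "\<delta> = min (e / 2) (c * r\<^sup>2 / 2)"
    have \<delta>: "\<delta> > 0" using e c r by (simp add: \<delta>_def)
    have "\<forall>\<^sub>F k in sequentially. W k < V + c * r\<^sup>2 / 2"
      using V(1) c r by (intro order_tendstoD) auto
    then have "\<forall>\<^sub>F k in sequentially. a (Suc k) \<ge> V - \<delta> \<longrightarrow> a k \<ge> V - e"
    proof (eventually_elim, intro impI)
      fix k assume k: "W k < V + c * r\<^sup>2 / 2" "a (Suc k) \<ge> V - \<delta>"
      have "c * (D k)\<^sup>2 \<le> W k - a (Suc k)" using step[of k] by simp
      also have "\<dots> < c * r\<^sup>2" using k by (simp add: \<delta>_def)
      finally have "(D k)\<^sup>2 < r\<^sup>2" using c by simp
      then have "D k < r" using r(1) by (meson less_eq_real_def power2_less_imp_less)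
      then have "dist (\<phi> (x (Suc k))) (\<phi> (x k)) < e / 2"
        using r(2)[OF xS[of k] xS[of "Suc k"]] by (simp add: D_def dist_norm)
      then have "a k \<ge> a (Suc k) - e / 2" unfolding a_def dist_real_def by linarith
      then show "a k \<ge> V - e" using k(2) unfolding \<delta>_def by linarith
    qed
    then show ?thesis using \<delta> by blast
  qed
  have backj: "\<exists>\<delta>>0. \<forall>\<^sub>F k in sequentially. a (k + j) \<ge> V - \<delta> \<longrightarrow> a k \<ge> V - e"
    if e: "e > 0" for e j
  proof (induction j)
    case 0
    then show ?case using e by (intro exI[of _ e]) auto
  next
    case (Suc j)
    then obtain \<delta> where \<delta>: "\<delta> > 0" "\<forall>\<^sub>F k in sequentially. a (k + j) \<ge> V - \<delta> \<longrightarrow> a k \<ge> V - e"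
      by blast
    obtain \<gamma> where \<gamma>: "\<gamma> > 0" "\<forall>\<^sub>F k in sequentially. a (Suc k) \<ge> V - \<gamma> \<longrightarrow> a k \<ge> V - \<delta>"
      using pull[OF \<delta>(1)] by blast
    have "\<forall>\<^sub>F k in sequentially. a (Suc (k + j)) \<ge> V - \<gamma> \<longrightarrow> a (k + j) \<ge> V - \<delta>"
      using \<gamma>(2) by (rule eventually_compose_filterlim) (rule filterlim_add_const_nat_at_top)
    with \<delta>(2) have "\<forall>\<^sub>F k in sequentially. a (k + Suc j) \<ge> V - \<gamma> \<longrightarrow> a k \<ge> V - e"
      by eventually_elim simp
    then show ?case using \<gamma>(1) by blast
  qed
  have lower: "\<forall>\<^sub>F k in sequentially. a k \<ge> V - e" if e: "e > 0" for e
  proof -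
    have "\<forall>\<^sub>F k in sequentially. \<forall>j\<in>{..m}. a (k + j) \<ge> V \<longrightarrow> a k \<ge> V - e"
    proof (rule eventually_ball_finite; safe?)
      fix j
      obtain \<delta> where "\<delta> > 0" "\<forall>\<^sub>F k in sequentially. a (k + j) \<ge> V - \<delta> \<longrightarrow> a k \<ge> V - e"
        using backj[OF e] by blast
      then show "\<forall>\<^sub>F k in sequentially. a (k + j) \<ge> V \<longrightarrow> a k \<ge> V - e"
        by (auto elim!: eventually_mono)
    qed
    then show ?thesis
      by (rule eventually_mono) (use window in auto)
  qed
  have lim: "a \<longlonglongrightarrow> V"
  proof (rule order_tendstoI)
    fix u assume "u < V"
    then show "\<forall>\<^sub>F k in sequentially. u < a k"
      using lower[of "(V - u) / 2"] by (auto elim!: eventually_mono simp: field_simps)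
  next
    fix u assume "V < u"
    with V(1) have "\<forall>\<^sub>F k in sequentially. W k < u" by (rule order_tendstoD)
    then show "\<forall>\<^sub>F k in sequentially. a k < u" by (rule eventually_mono) (use aW le_less_trans in blast)
  qed
  then show "convergent (\<lambda>k. \<phi> (x k))" by (auto simp: convergent_def a_def[abs_def])
  have "(\<lambda>k. (W k - a (Suc k)) / c) \<longlonglongrightarrow> (V - V) / c"
    by (intro tendsto_intros V(1) LIMSEQ_Suc lim) (use c in auto)
  then have "(\<lambda>k. (W k - a (Suc k)) / c) \<longlonglongrightarrow> 0" by simp
  moreover have "(D k)\<^sup>2 \<le> (W k - a (Suc k)) / c" for k
    using step[of k] c by (simp add: field_simps)
  ultimately have "(\<lambda>k. (D k)\<^sup>2) \<longlonglongrightarrow> 0"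
    by (intro tendsto_sandwich[of "\<lambda>_. 0" "\<lambda>k. (D k)\<^sup>2" sequentially "\<lambda>k. (W k - a (Suc k)) / c" 0]) auto
  then have "(\<lambda>k. sqrt ((D k)\<^sup>2)) \<longlonglongrightarrow> sqrt 0" by (intro tendsto_intros)
  then show "(\<lambda>k. norm (x (Suc k) - x k)) \<longlonglongrightarrow> 0" by (simp add: D_def)
qed

section \<open>Block decomposition and gradient inequalities\<close>

lemma block_mem: "block blk i v \<in> block_space blk i"
  by (simp add: block_def block_space_def)

lemma block_add: "block blk i (v + w) = block blk i v + block blk i w"
  by (simp add: block_def vec_eq_iff)

lemma block_same: "s \<in> block_space blk i \<Longrightarrow> block blk i s = s"
  by (auto simp: block_def block_space_def vec_eq_iff)

lemma block_other: "s \<in> block_space blk i \<Longrightarrow> j \<noteq> i \<Longrightarrow> block blk j s = 0"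
  by (auto simp: block_def block_space_def vec_eq_iff)

lemma block_space_scaleR: "s \<in> block_space blk i \<Longrightarrow> t *\<^sub>R s \<in> block_space blk i"
  by (auto simp: block_space_def)

lemma block_space_add: "s \<in> block_space blk i \<Longrightarrow> v \<in> block_space blk i \<Longrightarrow> s + v \<in> block_space blk i"
  by (auto simp: block_space_def)

lemma sum_block: "(\<Sum>i\<in>UNIV. block blk i v) = v"
  for blk :: "'n::finite \<Rightarrow> 'b::finite"
  by (simp add: block_def vec_eq_iff if_distrib)

lemma inner_block: "s \<in> block_space blk i \<Longrightarrow> block blk i g \<bullet> s = g \<bullet> s"
  by (auto simp: inner_vec_def block_def block_space_def intro!: sum.cong)

lemma inner_blocks: "block blk i g \<bullet> block blk i v = block blk i g \<bullet> v"
  by (auto simp: inner_vec_def block_def intro!: sum.cong)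

lemma sum_inner_block: "(\<Sum>i\<in>UNIV. block blk i g \<bullet> v) = g \<bullet> v"
  for blk :: "'n::finite \<Rightarrow> 'b::finite"
  by (simp add: sum_block flip: inner_sum_left)

lemma sum_norm_block: "(\<Sum>i\<in>UNIV. (norm (block blk i v))\<^sup>2) = (norm v)\<^sup>2"
  for blk :: "'n::finite \<Rightarrow> 'b::finite"
proof -
  have "(norm (block blk i v))\<^sup>2 = block blk i v \<bullet> v" for i
    by (simp add: power2_norm_eq_inner inner_blocks)
  then show ?thesis by (simp add: sum_inner_block power2_norm_eq_inner)
qed

lemma GDERIV_line:
  assumes "\<And>y. GDERIV f y :> g y"
  shows "((\<lambda>t. f (x + t *\<^sub>R v)) has_field_derivative g (x + t *\<^sub>R v) \<bullet> v) (at t)"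
proof -
  have "(f has_derivative (\<lambda>h. h \<bullet> g (x + t *\<^sub>R v))) (at (x + t *\<^sub>R v))"
    using assms unfolding gderiv_def by blast
  then have "((\<lambda>t. f (x + t *\<^sub>R v)) has_derivative (\<lambda>h. (h *\<^sub>R v) \<bullet> g (x + t *\<^sub>R v))) (at t)"
    by (rule has_derivative_compose[rotated]) (auto intro!: derivative_eq_intros)
  then show ?thesis
    unfolding has_field_derivative_def
    by (rule has_derivative_eq_rhs) (auto simp: inner_commute)
qed

lemma convex_above_gradient:
  assumes "\<And>y. GDERIV f y :> g y" and "convex_on UNIV f"
  shows "f y \<ge> f x + g x \<bullet> (y - x)"
proof -
  have "convex_on UNIV (\<lambda>t. f (x + t *\<^sub>R (y - x)))"
  proof (rule convex_onI)
    fix t u v :: real assume t: "0 < t" "t < 1"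
    have eq: "x + ((1 - t) *\<^sub>R u + t *\<^sub>R v) *\<^sub>R (y - x)
        = (1 - t) *\<^sub>R (x + u *\<^sub>R (y - x)) + t *\<^sub>R (x + v *\<^sub>R (y - x))"
      by (simp add: algebra_simps)
    show "f (x + ((1 - t) *\<^sub>R u + t *\<^sub>R v) *\<^sub>R (y - x))
        \<le> (1 - t) * f (x + u *\<^sub>R (y - x)) + t * f (x + v *\<^sub>R (y - x))"
      unfolding eq using t by (intro convex_onD[OF assms(2)]) auto
  qed auto
  from convex_on_imp_above_tangent[OF this, of 0 1 "g x \<bullet> (y - x)"] GDERIV_line[OF assms(1), of x "y - x" 0]
  show ?thesis by simp
qed

lemma Lipschitz_gradient_upper_bound:
  assumes grad: "\<And>y. GDERIV f y :> g y"
    and lip: "\<And>t. 0 \<le> t \<Longrightarrow> t \<le> 1 \<Longrightarrow> (g (x + t *\<^sub>R s) - g x) \<bullet> s \<le> t * (C * (norm s)\<^sup>2)"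
  shows "f (x + s) \<le> f x + g x \<bullet> s + C / 2 * (norm s)\<^sup>2"
proof -
  define h where "h t = f (x + t *\<^sub>R s) - t * (g x \<bullet> s) - t\<^sup>2 * (C / 2 * (norm s)\<^sup>2)" for t
  have "h 1 \<le> h 0"
  proof (rule DERIV_nonpos_imp_nonincreasing[where f = h])
    fix t :: real assume t: "0 \<le> t" "t \<le> 1"
    have "(h has_field_derivative (g (x + t *\<^sub>R s) - g x) \<bullet> s - t * (C * (norm s)\<^sup>2)) (at t)"
      unfolding h_def[abs_def]
      by (auto intro!: derivative_eq_intros GDERIV_line grad simp: inner_diff_left)
    then show "\<exists>y. DERIV h t :> y \<and> y \<le> 0" using lip[OF t] by fastforce
  qed simp
  then show ?thesis by (simp add: h_def)
qed

section \<open>Proximal steps in one block\<close>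

locale block_composite =
  fixes blk :: "'n::finite \<Rightarrow> 'b::finite"
    and f :: "real ^ 'n \<Rightarrow> real" and gradf :: "real ^ 'n \<Rightarrow> real ^ 'n"
    and psi :: "'b \<Rightarrow> real ^ 'n \<Rightarrow> ereal"
    and L :: "'b \<Rightarrow> real"
  assumes grad: "\<And>y. GDERIV f y :> gradf y"
    and lipschitz: "\<And>i y h. h \<in> block_space blk i \<Longrightarrow>
          norm (block blk i (gradf (y + h)) - block blk i (gradf y)) \<le> L i * norm h"
    and psi_not_MInf: "\<And>i s. s \<in> block_space blk i \<Longrightarrow> psi i s \<noteq> -\<infinity>"
    and f_convex: "convex_on UNIV f"
    and psi_convex: "convex_ereal (sepfun blk psi)"
begin

abbreviation "F \<equiv> composite blk f psi"
abbreviation "obj y \<equiv> real_of_ereal (F y)"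
definition "block_psi i y = real_of_ereal (psi i (block blk i y))"

lemma psi_block_finite:
  assumes "F y < \<infinity>"
  shows "psi i (block blk i y) = ereal (block_psi i y)"
proof -
  have "sepfun blk psi y \<noteq> \<infinity>" using assms by (auto simp: composite_def)
  then have "psi i (block blk i y) \<noteq> \<infinity>" by (auto simp: sepfun_def sum_Pinfty)
  then show ?thesis using psi_not_MInf[OF block_mem, of i y]
    by (cases "psi i (block blk i y)") (auto simp: block_psi_def)
qed

lemma composite_finite:
  assumes "F y < \<infinity>"
  shows "F y = ereal (f y + (\<Sum>i\<in>UNIV. block_psi i y))"
proof -
  have "sepfun blk psi y = (\<Sum>i\<in>UNIV. ereal (block_psi i y))"
    unfolding sepfun_def by (intro sum.cong psi_block_finite[OF assms] refl)
  then show ?thesis by (simp add: composite_def)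
qed

lemma sepfun_change_block:
  assumes "\<And>j. j \<noteq> i \<Longrightarrow> block blk j w = block blk j x" and "F x < \<infinity>"
  shows "sepfun blk psi w = psi i (block blk i w) + ereal (\<Sum>j\<in>UNIV - {i}. block_psi j x)"
proof -
  have "sepfun blk psi w = psi i (block blk i w) + (\<Sum>j\<in>UNIV - {i}. psi j (block blk j w))"
    unfolding sepfun_def by (subst sum.remove[of _ i]) auto
  also have "(\<Sum>j\<in>UNIV - {i}. psi j (block blk j w)) = (\<Sum>j\<in>UNIV - {i}. ereal (block_psi j x))"
    using assms psi_block_finite[OF assms(2)] by (intro sum.cong) auto
  finally show ?thesis by simp
qed

lemma composite_change_block:
  assumes "s \<in> block_space blk i" and "F x < \<infinity>" and "psi i (block blk i x + s) = ereal r"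
  shows "F (x + s) = ereal (obj x + (f (x + s) - f x) + (r - block_psi i x))"
proof -
  have blocks: "block blk j (x + s) = block blk j x" if "j \<noteq> i" for j
    using that assms(1) by (simp add: block_add block_other)
  have "sepfun blk psi (x + s) = ereal (r + (\<Sum>j\<in>UNIV - {i}. block_psi j x))"
    using sepfun_change_block[OF blocks assms(2)] assms(1,3) by (simp add: block_add block_same)
  moreover have "obj x = f x + (block_psi i x + (\<Sum>j\<in>UNIV - {i}. block_psi j x))"
    using composite_finite[OF assms(2)] by (simp add: sum.remove[of UNIV i])
  ultimately show ?thesis by (simp add: composite_def)
qed

text \<open>
  Convexity is assumed only for the sum of the block functions. Changing the single block \<open>i\<close> of
  \<open>x\<close> keeps the other summands fixed and finite, so they cancel.
\<close>

lemma psi_segment_le: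
  assumes "F x < \<infinity>" "F y < \<infinity>" "0 \<le> t" "t \<le> 1"
  shows "psi i (block blk i x + t *\<^sub>R block blk i (y - x))
    \<le> ereal ((1 - t) * block_psi i x + t * block_psi i y)"
proof -
  define z where "z = x + block blk i (y - x)"
  define R where "R = (\<Sum>j\<in>UNIV - {i}. block_psi j x)"
  \<comment> \<open>\<open>z\<close> is \<open>x\<close> with its block \<open>i\<close> replaced by that of \<open>y\<close>, so the segment from \<open>x\<close> to \<open>z\<close> moves in
    block \<open>i\<close> only.\<close>
  have bz: "block blk i z = block blk i y"
    by (simp add: z_def block_def vec_eq_iff)
  have "sepfun blk psi z = psi i (block blk i y) + ereal R"
    unfolding R_def bz[symmetric]
    by (rule sepfun_change_block[OF _ assms(1)]) (simp add: z_def block_add block_other[OF block_mem])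
  then have sz: "sepfun blk psi z = ereal (block_psi i y + R)"
    using psi_block_finite[OF assms(2), of i] by (metis plus_ereal.simps(1))
  have "sepfun blk psi x = psi i (block blk i x) + ereal R"
    unfolding R_def by (rule sepfun_change_block[OF _ assms(1)]) simp
  then have sx: "sepfun blk psi x = ereal (block_psi i x + R)"
    using psi_block_finite[OF assms(1), of i] by (metis plus_ereal.simps(1))
  have bi: "block blk i ((1 - t) *\<^sub>R x + t *\<^sub>R z) = block blk i x + t *\<^sub>R block blk i (y - x)"
    and bj: "j \<noteq> i \<Longrightarrow> block blk j ((1 - t) *\<^sub>R x + t *\<^sub>R z) = block blk j x" for j
    unfolding z_def
    by (auto simp: vec_eq_iff block_def algebra_simps)
  have "sepfun blk psi ((1 - t) *\<^sub>R x + t *\<^sub>R z)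
      = psi i (block blk i x + t *\<^sub>R block blk i (y - x)) + ereal R"
    unfolding R_def bi[symmetric] by (rule sepfun_change_block[OF _ assms(1)]) (rule bj)
  moreover have "sepfun blk psi ((1 - t) *\<^sub>R x + t *\<^sub>R z)
      \<le> ereal (1 - t) * sepfun blk psi x + ereal t * sepfun blk psi z"
    using psi_convex assms(3,4) unfolding convex_ereal_def by auto
  ultimately have "psi i (block blk i x + t *\<^sub>R block blk i (y - x)) + ereal R
      \<le> ereal ((1 - t) * (block_psi i x + R) + t * (block_psi i y + R))"
    by (simp add: sx sz)
  then show ?thesis
    by (cases "psi i (block blk i x + t *\<^sub>R block blk i (y - x))") (auto simp: algebra_simps)
qed

lemma block_descent:
  assumes s: "s \<in> block_space blk i"
  shows "f (x + s) \<le> f x + gradf x \<bullet> s + L i / 2 * (norm s)\<^sup>2"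
proof (rule Lipschitz_gradient_upper_bound[OF grad])
  fix t :: real assume t: "0 \<le> t" "t \<le> 1"
  have "(gradf (x + t *\<^sub>R s) - gradf x) \<bullet> s
      = (block blk i (gradf (x + t *\<^sub>R s)) - block blk i (gradf x)) \<bullet> s"
    using inner_block[OF s] by (simp add: inner_diff_left)
  also have "\<dots> \<le> norm (block blk i (gradf (x + t *\<^sub>R s)) - block blk i (gradf x)) * norm s"
    by (rule norm_cauchy_schwarz)
  also have "\<dots> \<le> L i * norm (t *\<^sub>R s) * norm s"
    by (intro mult_right_mono lipschitz block_space_scaleR s) auto
  finally show "(gradf (x + t *\<^sub>R s) - gradf x) \<bullet> s \<le> t * (L i * (norm s)\<^sup>2)"
    using t by (simp add: power2_eq_square mult_ac)
qed

text \<open>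
  The minimizer is compared with the \<open>i\<close>-th block of \<open>t (y - x)\<close>. For \<open>y = x\<close> (or \<open>t = 0\<close>) this
  is the zero step, which yields the decrease of \<open>F\<close>; for optimal \<open>y\<close> it relates the step to the
  optimality gap.
\<close>

lemma prox_step_compare:
  assumes prox: "is_prox_step blk gradf psi i x \<theta> s" and x: "F x < \<infinity>" and y: "F y < \<infinity>"
    and t: "0 \<le> t" "t \<le> 1"
  obtains r where "psi i (block blk i x + s) = ereal r"
    and "gradf x \<bullet> s + \<theta> / 2 * (norm s)\<^sup>2 + (r - block_psi i x)
      \<le> t * (block blk i (gradf x) \<bullet> (y - x) + block_psi i y - block_psi i x)
          + \<theta> / 2 * t\<^sup>2 * (norm (block blk i (y - x)))\<^sup>2"
proof -
  let ?v = "block blk i (y - x)"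
  have s: "s \<in> block_space blk i" using prox by (auto simp: is_prox_step_def is_arg_min_def)
  have "t *\<^sub>R ?v \<in> block_space blk i" by (intro block_space_scaleR block_mem)
  then have "prox_model blk gradf psi i x \<theta> s \<le> prox_model blk gradf psi i x \<theta> (t *\<^sub>R ?v)"
    using prox by (auto simp: is_prox_step_def is_arg_min_def not_less)
  also have "\<dots> \<le> ereal (block blk i (gradf x) \<bullet> (t *\<^sub>R ?v) + \<theta> / 2 * (norm (t *\<^sub>R ?v))\<^sup>2)
      + ereal ((1 - t) * block_psi i x + t * block_psi i y)"
    unfolding prox_model_def by (intro add_mono psi_segment_le x y t order_refl)
  finally have le: "ereal (gradf x \<bullet> s + \<theta> / 2 * (norm s)\<^sup>2) + psi i (block blk i x + s)
      \<le> ereal (t * (block blk i (gradf x) \<bullet> (y - x)) + \<theta> / 2 * t\<^sup>2 * (norm ?v)\<^sup>2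
        + ((1 - t) * block_psi i x + t * block_psi i y))"
    by (simp add: prox_model_def power_mult_distrib inner_block[OF s] inner_blocks add_ac mult_ac)
  have "psi i (block blk i x + s) \<noteq> -\<infinity>"
    using psi_not_MInf[OF block_space_add[OF block_mem s]] .
  with le obtain r where r: "psi i (block blk i x + s) = ereal r"
    by (cases "psi i (block blk i x + s)") auto
  show ?thesis
    using le[unfolded r plus_ereal.simps ereal_less_eq]
    by (intro that[OF r]) (simp add: algebra_simps)
qed

lemma prox_step_decrease:
  assumes prox: "is_prox_step blk gradf psi i x \<theta> s" and x: "F x < \<infinity>"
  shows "F (x + s) \<le> ereal (obj x - (\<theta> - L i) / 2 * (norm s)\<^sup>2)"
proof -
  have s: "s \<in> block_space blk i" using prox by (auto simp: is_prox_step_def is_arg_min_def)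
  obtain r where r: "psi i (block blk i x + s) = ereal r"
    "gradf x \<bullet> s + \<theta> / 2 * (norm s)\<^sup>2 + (r - block_psi i x) \<le> 0"
    using prox_step_compare[OF prox x x, of 0] by auto
  have "(\<theta> - L i) / 2 * (norm s)\<^sup>2 = \<theta> / 2 * (norm s)\<^sup>2 - L i / 2 * (norm s)\<^sup>2"
    by (simp add: diff_divide_distrib left_diff_distrib)
  then have "obj x + (f (x + s) - f x) + (r - block_psi i x) \<le> obj x - (\<theta> - L i) / 2 * (norm s)\<^sup>2"
    using r(2) block_descent[OF s, of x] by linarith
  then show ?thesis
    unfolding composite_change_block[OF s x r(1)] by simp
qed

text \<open>
  The left-hand side is close to zero when the step makes little progress. Once \<open>y\<close> and \<open>t\<close> are
  chosen from \<open>x\<close>, the right-hand side depends on \<open>x\<close> and the block only, neither on the step nor on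
  the proximal parameter, so it can be averaged over all blocks at a fixed iterate.
\<close>

lemma prox_step_gap:
  assumes prox: "is_prox_step blk gradf psi i x \<theta> s" and \<theta>: "0 \<le> \<theta>" "\<theta> \<le> \<Theta>"
    and x: "F x < \<infinity>" and y: "F y < \<infinity>" and t: "0 \<le> t" "t \<le> 1"
  shows "obj (x + s) - obj x - L i / 2 * (norm s)\<^sup>2
      \<le> t * (block blk i (gradf x) \<bullet> (y - x) + block_psi i y - block_psi i x)
          + \<Theta> / 2 * t\<^sup>2 * (norm (block blk i (y - x)))\<^sup>2"
proof -
  have s: "s \<in> block_space blk i" using prox by (auto simp: is_prox_step_def is_arg_min_def)
  obtain r where r: "psi i (block blk i x + s) = ereal r"
    "gradf x \<bullet> s + \<theta> / 2 * (norm s)\<^sup>2 + (r - block_psi i x)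
      \<le> t * (block blk i (gradf x) \<bullet> (y - x) + block_psi i y - block_psi i x)
          + \<theta> / 2 * t\<^sup>2 * (norm (block blk i (y - x)))\<^sup>2"
    using prox_step_compare[OF prox x y t] by metis
  have "\<theta> / 2 * t\<^sup>2 * (norm (block blk i (y - x)))\<^sup>2 \<le> \<Theta> / 2 * t\<^sup>2 * (norm (block blk i (y - x)))\<^sup>2"
    using \<theta> by (intro mult_right_mono) auto
  moreover have "0 \<le> \<theta> / 2 * (norm s)\<^sup>2" using \<theta> by simp
  ultimately show ?thesis
    unfolding composite_change_block[OF s x r(1)] using r(2) block_descent[OF s, of x]
    unfolding real_of_ereal.simps by linarith
qed

lemma sum_gap:
  assumes x: "F x < \<infinity>" and y: "F y < \<infinity>" and t: "0 \<le> t"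
  shows "(\<Sum>i\<in>UNIV. t * (block blk i (gradf x) \<bullet> (y - x) + block_psi i y - block_psi i x)
          + c * (norm (block blk i (y - x)))\<^sup>2)
      \<le> c * (norm (y - x))\<^sup>2 - t * (obj x - obj y)"
proof -
  have "(\<Sum>i\<in>UNIV. t * (block blk i (gradf x) \<bullet> (y - x) + block_psi i y - block_psi i x)
          + c * (norm (block blk i (y - x)))\<^sup>2)
      = t * (gradf x \<bullet> (y - x) + (\<Sum>i\<in>UNIV. block_psi i y) - (\<Sum>i\<in>UNIV. block_psi i x))
        + c * (norm (y - x))\<^sup>2"
    by (simp add: sum.distrib sum_subtractf sum_inner_block sum_norm_block flip: sum_distrib_left)
  also have "\<dots> \<le> t * (obj y - obj x) + c * (norm (y - x))\<^sup>2"
    using convex_above_gradient[OF grad f_convex, of x y] composite_finite[OF x] composite_finite[OF y] t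
    by (intro add_right_mono mult_left_mono) auto
  finally show ?thesis by (simp add: algebra_simps)
qed

lemma obj_eq: "F y < \<infinity> \<Longrightarrow> F y = ereal (obj y)"
  using composite_finite[of y] by simp

lemma sufficient_decrease_finite:
  assumes "\<And>l. l \<le> k \<Longrightarrow> F (x l) < \<infinity>"
  shows "sufficient_decrease F \<sigma> m x k s
    \<longleftrightarrow> F (x k + s) \<le> ereal (Max ((\<lambda>l. obj (x l)) ` {k - m..k}) - \<sigma> / 2 * (norm s)\<^sup>2)"
proof -
  have "(\<lambda>l. F (x l)) ` {k - m..k} = ereal ` (\<lambda>l. obj (x l)) ` {k - m..k}"
    unfolding image_image using obj_eq[OF assms] by (intro image_cong) auto
  then have "Max ((\<lambda>l. F (x l)) ` {k - m..k}) = ereal (Max ((\<lambda>l. obj (x l)) ` {k - m..k}))"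
    by (simp add: mono_Max_commute[symmetric] mono_def)
  then show ?thesis by (simp add: sufficient_decrease_def)
qed

section \<open>Runs of the method\<close>

text \<open>
  A proximal parameter of at least \<open>L i + \<sigma>\<close> already makes the ordinary monotone decrease large
  enough, so the backtracking never raises the parameter beyond \<open>\<eta> * (L i + \<sigma>)\<close>.
\<close>

lemma prox_step_sufficient_decrease:
  assumes prox: "is_prox_step blk gradf psi i (x k) \<theta> s" and large: "L i + \<sigma> \<le> \<theta>"
    and fin: "\<And>l. l \<le> k \<Longrightarrow> F (x l) < \<infinity>"
  shows "sufficient_decrease F \<sigma> m x k s"
proof -
  have "F (x k + s) \<le> ereal (obj (x k) - (\<theta> - L i) / 2 * (norm s)\<^sup>2)"
    by (rule prox_step_decrease[OF prox fin]) simp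
  also have "\<dots> \<le> ereal (Max ((\<lambda>l. obj (x l)) ` {k - m..k}) - \<sigma> / 2 * (norm s)\<^sup>2)"
    unfolding ereal_less_eq using large by (intro diff_mono mult_right_mono Max_ge) auto
  finally show ?thesis by (simp add: sufficient_decrease_finite[OF fin])
qed

context
  fixes \<eta> \<sigma> \<theta>lo \<theta>hi :: real and m :: nat and x0 idx \<theta>0 x d
  assumes run: "rnbpg_run blk f gradf psi \<eta> \<sigma> \<theta>lo \<theta>hi m x0 idx \<theta>0 x d"
    and x0_dom: "F x0 < \<infinity>" and params: "\<eta> > 1" "\<sigma> > 0" "\<theta>lo > 0"
begin

lemma run_step: "x (Suc k) = x k + d k"
  using run by (simp add: rnbpg_run_def)

lemma run_finite: "F (x k) < \<infinity>"
proof (induction k rule: less_induct)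
  case (less k)
  show ?case
  proof (cases k)
    case 0
    then show ?thesis using run x0_dom by (simp add: rnbpg_run_def)
  next
    case (Suc l)
    have fin: "\<And>i. i \<le> l \<Longrightarrow> F (x i) < \<infinity>" using less Suc by simp
    have "sufficient_decrease F \<sigma> m x l (d l)" using conjunct2[OF run[unfolded rnbpg_run_def], THEN spec, of l] by auto
    then have "F (x k) \<le> ereal (Max ((\<lambda>i. obj (x i)) ` {l - m..l}) - \<sigma> / 2 * (norm (d l))\<^sup>2)"
      using sufficient_decrease_finite[OF fin] by (simp add: run_step Suc)
    then show ?thesis using le_less_trans by fastforce
  qed
qed

lemma run_descent:
  "obj (x (Suc k)) \<le> Max ((\<lambda>l. obj (x l)) ` {k - m..k}) - \<sigma> / 2 * (norm (d k))\<^sup>2"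
proof -
  have "sufficient_decrease F \<sigma> m x k (d k)" using conjunct2[OF run[unfolded rnbpg_run_def], THEN spec, of k] by auto
  then have "F (x (Suc k)) \<le> ereal (Max ((\<lambda>l. obj (x l)) ` {k - m..k}) - \<sigma> / 2 * (norm (d k))\<^sup>2)"
    using sufficient_decrease_finite[OF run_finite] by (simp add: run_step)
  then show ?thesis using obj_eq[OF run_finite[of "Suc k"]] by (metis ereal_less_eq(3))
qed

lemma run_window_le: "Max ((\<lambda>l. obj (x l)) ` {k - m..k}) \<le> obj x0"
proof -
  have "obj (x (Suc k)) \<le> Max ((\<lambda>l. obj (x l)) ` {k - m..k})" for k
  proof -
    have "0 \<le> \<sigma> / 2 * (norm (d k))\<^sup>2" using params by simp
    then show ?thesis using run_descent[of k] by linarith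
  qed
  note le = nonmonotone_le_initial[of "\<lambda>l. obj (x l)" m k, OF this]
  have "x 0 = x0" using run by (simp add: rnbpg_run_def)
  then show ?thesis using le by (simp only:)
qed

lemma run_le_initial: "obj (x k) \<le> obj x0"
proof -
  have "obj (x k) \<le> Max ((\<lambda>l. obj (x l)) ` {k - m..k})"
    by (intro Max_ge finite_imageI finite_atLeastAtMost imageI) simp
  then show ?thesis using run_window_le[of k] by (rule order_trans)
qed

lemma run_prox_step:
  obtains \<theta> where "is_prox_step blk gradf psi (idx k) (x k) \<theta> (d k)" "0 \<le> \<theta>"
    "\<theta> \<le> max \<theta>hi (\<eta> * (L (idx k) + \<sigma>))"
proof -
  have step: "\<theta>0 k \<in> {\<theta>lo..\<theta>hi} \<and>
      (\<exists>j s. (\<forall>l\<le>j. is_prox_step blk gradf psi (idx k) (x k) (\<theta>0 k * \<eta> ^ l) (s l)) \<and>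
             (\<forall>l<j. \<not> sufficient_decrease F \<sigma> m x k (s l)) \<and>
             sufficient_decrease F \<sigma> m x k (s j) \<and> d k = s j)"
    using run unfolding rnbpg_run_def by blast
  then have \<theta>0: "\<theta>lo \<le> \<theta>0 k" "\<theta>0 k \<le> \<theta>hi" by simp_all
  obtain j s where js: "\<forall>l\<le>j. is_prox_step blk gradf psi (idx k) (x k) (\<theta>0 k * \<eta> ^ l) (s l)"
    "\<forall>l<j. \<not> sufficient_decrease F \<sigma> m x k (s l)" "d k = s j"
    using step by blast
  have "\<theta>0 k * \<eta> ^ j \<le> max \<theta>hi (\<eta> * (L (idx k) + \<sigma>))"
  proof (cases j)
    case 0
    then show ?thesis using \<theta>0 by simp
  next
    case (Suc l)
    have "\<theta>0 k * \<eta> ^ l < L (idx k) + \<sigma>"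
    proof (rule ccontr)
      assume large: "\<not> \<theta>0 k * \<eta> ^ l < L (idx k) + \<sigma>"
      have "is_prox_step blk gradf psi (idx k) (x k) (\<theta>0 k * \<eta> ^ l) (s l)" using js(1) Suc by simp
      then have "sufficient_decrease F \<sigma> m x k (s l)"
        by (rule prox_step_sufficient_decrease) (use large run_finite in auto)
      then show False using js(2) Suc by simp
    qed
    then have "\<eta> * (\<theta>0 k * \<eta> ^ l) \<le> \<eta> * (L (idx k) + \<sigma>)" using params by simp
    then show ?thesis by (simp add: Suc mult_ac)
  qed
  moreover have "0 \<le> \<theta>0 k * \<eta> ^ j" using \<theta>0 params by simp
  moreover have "is_prox_step blk gradf psi (idx k) (x k) (\<theta>0 k * \<eta> ^ j) (d k)" using js(1,3) by simp
  ultimately show ?thesis by (intro that)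
qed

end

end

section \<open>Functions of finitely many random indices\<close>

locale index_process = prob_space P for P :: "'w measure" +
  fixes idx :: "nat \<Rightarrow> 'w \<Rightarrow> 'b::finite"
  assumes indep: "indep_vars (\<lambda>_. count_space UNIV) idx UNIV"
begin

text \<open>
  The functions measurable with respect to the first \<open>k\<close> indices. As these take finitely many
  values, such a function is simple and no structure on its codomain is needed.
\<close>

definition known :: "nat \<Rightarrow> ('w \<Rightarrow> 'c) \<Rightarrow> bool" where
  "known k g \<longleftrightarrow> (\<forall>\<omega>\<in>space P. \<forall>\<omega>'\<in>space P. (\<forall>l<k. idx l \<omega> = idx l \<omega>') \<longrightarrow> g \<omega> = g \<omega>')"

lemma known_compose: "known k g \<Longrightarrow> known k (\<lambda>\<omega>. h (g \<omega>))"
  unfolding known_def by metis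

lemma known_compose2: "known k g \<Longrightarrow> known k g' \<Longrightarrow> known k (\<lambda>\<omega>. h (g \<omega>) (g' \<omega>))"
  unfolding known_def by metis

lemma known_mono: "known k g \<Longrightarrow> k \<le> l \<Longrightarrow> known l g"
  unfolding known_def by (meson less_le_trans)

lemma known_cong: "known k g \<Longrightarrow> (\<And>\<omega>. \<omega> \<in> space P \<Longrightarrow> g' \<omega> = g \<omega>) \<Longrightarrow> known k g'"
  unfolding known_def by metis

lemma known_idx: "known (Suc k) (idx k)"
  by (auto simp: known_def)

lemma known_factor:
  assumes "known k g"
  obtains h where "\<And>\<omega>. \<omega> \<in> space P \<Longrightarrow> g \<omega> = h (restrict (\<lambda>l. idx l \<omega>) {..<k})"
proof -
  define h where "h a = g (SOME \<omega>. \<omega> \<in> space P \<and> restrict (\<lambda>l. idx l \<omega>) {..<k} = a)" for a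
  have "g \<omega> = h (restrict (\<lambda>l. idx l \<omega>) {..<k})" if \<omega>: "\<omega> \<in> space P" for \<omega>
  proof -
    define \<omega>' where "\<omega>' = (SOME \<omega>'. \<omega>' \<in> space P
      \<and> restrict (\<lambda>l. idx l \<omega>') {..<k} = restrict (\<lambda>l. idx l \<omega>) {..<k})"
    have \<omega>': "\<omega>' \<in> space P \<and> restrict (\<lambda>l. idx l \<omega>') {..<k} = restrict (\<lambda>l. idx l \<omega>) {..<k}"
      unfolding \<omega>'_def by (rule someI[of _ \<omega>]) (use \<omega> in simp)
    then have "\<forall>l<k. idx l \<omega> = idx l \<omega>'" by (metis lessThan_iff restrict_apply')
    then show ?thesis using assms \<omega> \<omega>' unfolding known_def h_def \<omega>'_def by blast
  qed
  then show ?thesis by (rule that)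
qed

lemma idx_measurable: "idx k \<in> measurable P (count_space UNIV)"
  using indep by (simp add: indep_vars_def)

lemma history_measurable:
  "(\<lambda>\<omega>. restrict (\<lambda>l. idx l \<omega>) {..<k}) \<in> measurable P (PiM {..<k} (\<lambda>_. count_space UNIV))"
  by (intro measurable_restrict idx_measurable)

lemma history_space: "PiM {..<k::nat} (\<lambda>_. count_space UNIV) = count_space (PiE {..<k} (\<lambda>_. UNIV :: 'b set))"
  by (intro count_space_PiM_finite) auto

lemma known_measurable:
  assumes "known k g"
  shows "g \<in> measurable P (count_space UNIV)"
proof -
  obtain h where h: "\<And>\<omega>. \<omega> \<in> space P \<Longrightarrow> g \<omega> = h (restrict (\<lambda>l. idx l \<omega>) {..<k})"
    using known_factor[OF assms] by metis
  have "(\<lambda>\<omega>. h (restrict (\<lambda>l. idx l \<omega>) {..<k})) \<in> measurable P (count_space UNIV)"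
    by (rule measurable_compose[OF history_measurable]) (simp add: history_space)
  then show ?thesis using h by (subst measurable_cong) auto
qed

lemma known_integrable:
  fixes g :: "'w \<Rightarrow> real"
  assumes "known k g"
  shows "integrable P g"
proof -
  obtain h where h: "\<And>\<omega>. \<omega> \<in> space P \<Longrightarrow> g \<omega> = h (restrict (\<lambda>l. idx l \<omega>) {..<k})"
    using known_factor[OF assms] by metis
  have "finite (h ` PiE {..<k} (\<lambda>_. UNIV :: 'b set))" by (intro finite_imageI finite_PiE) auto
  moreover have "g ` space P \<subseteq> h ` PiE {..<k} (\<lambda>_. UNIV :: 'b set)" using h by auto
  ultimately have fin: "finite (g ` space P)" by (rule finite_subset[rotated])
  have g: "g \<in> borel_measurable P"
    using measurable_compose[OF known_measurable[OF assms], of "\<lambda>v. v" borel] by simp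
  show ?thesis
  proof (rule integrable_const_bound[of _ "Max ((\<lambda>\<omega>. \<bar>g \<omega>\<bar>) ` space P)"])
    have "finite ((\<lambda>\<omega>. \<bar>g \<omega>\<bar>) ` space P)"
      using finite_imageI[OF fin, of abs] by (simp add: image_image)
    then show "AE \<omega> in P. norm (g \<omega>) \<le> Max ((\<lambda>\<omega>. \<bar>g \<omega>\<bar>) ` space P)" by auto
  qed (rule g)
qed

text \<open>The index \<open>idx k\<close> is independent of \<open>g\<close>, since \<open>g\<close> factors through the earlier indices.\<close>

lemma expectation_next_index:
  fixes g :: "'w \<Rightarrow> real"
  assumes "known k g"
  shows "expectation (\<lambda>\<omega>. indicator {i} (idx k \<omega>) * g \<omega>)
    = prob {\<omega> \<in> space P. idx k \<omega> = i} * expectation g"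
proof -
  obtain h where h: "\<And>\<omega>. \<omega> \<in> space P \<Longrightarrow> g \<omega> = h (restrict (\<lambda>l. idx l \<omega>) {..<k})"
    using known_factor[OF assms] by metis
  have rest: "(\<lambda>a. indicator {i} (a k) :: real) \<in> borel_measurable (PiM {k} (\<lambda>_. count_space UNIV))"
    by (subst count_space_PiM_finite) auto
  have hist: "h \<in> borel_measurable (PiM {..<k} (\<lambda>_. count_space UNIV))"
    by (simp add: history_space)
  have "indep_var borel ((\<lambda>a. indicator {i} (a k) :: real) \<circ> (\<lambda>\<omega>. restrict (\<lambda>l. idx l \<omega>) {k}))
      borel (h \<circ> (\<lambda>\<omega>. restrict (\<lambda>l. idx l \<omega>) {..<k}))"
    by (rule indep_var_compose[OF indep_var_restrict[OF indep] rest hist]) auto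
  then have ind: "indep_var borel (\<lambda>\<omega>. indicator {i} (idx k \<omega>) :: real)
      borel (\<lambda>\<omega>. h (restrict (\<lambda>l. idx l \<omega>) {..<k}))"
    by (simp add: comp_def)
  have kh: "known k (\<lambda>\<omega>. h (restrict (\<lambda>l. idx l \<omega>) {..<k}))"
    unfolding known_def by (metis (no_types, lifting) lessThan_iff restrict_ext)
  have ki: "known (Suc k) (\<lambda>\<omega>. indicator {i} (idx k \<omega>) :: real)"
    by (rule known_compose[OF known_idx])
  have "expectation (\<lambda>\<omega>. indicator {i} (idx k \<omega>) * g \<omega>)
      = expectation (\<lambda>\<omega>. indicator {i} (idx k \<omega>) * h (restrict (\<lambda>l. idx l \<omega>) {..<k}))"
    using h by (intro Bochner_Integration.integral_cong) auto
  also have "\<dots> = expectation (\<lambda>\<omega>. indicator {i} (idx k \<omega>)) * expectation (\<lambda>\<omega>. h (restrict (\<lambda>l. idx l \<omega>) {..<k}))"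
    by (rule indep_var_lebesgue_integral[OF ind known_integrable[OF ki] known_integrable[OF kh]])
  also have "expectation (\<lambda>\<omega>. h (restrict (\<lambda>l. idx l \<omega>) {..<k})) = expectation g"
    using h by (intro Bochner_Integration.integral_cong) auto
  also have "expectation (\<lambda>\<omega>. indicator {i} (idx k \<omega>)) = expectation (indicator {\<omega> \<in> space P. idx k \<omega> = i})"
    by (intro Bochner_Integration.integral_cong) (auto simp: indicator_def)
  also have "\<dots> = prob {\<omega> \<in> space P. idx k \<omega> = i}"
    by (simp add: Int_absorb1 Int_absorb2 subset_eq)
  finally show ?thesis .
qed

text \<open>
  The sum over all blocks is recovered from the single block that is drawn. Hence the steps that
  the other blocks would have produced never have to be constructed.
\<close>

lemma expectation_importance_weighted:
  fixes Q :: "'b \<Rightarrow> 'w \<Rightarrow> real" and p :: "'b \<Rightarrow> real"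
  assumes Q: "\<And>i. known k (Q i)" and p: "\<And>i. prob {\<omega> \<in> space P. idx k \<omega> = i} = p i" "\<And>i. p i \<noteq> 0"
  shows "expectation (\<lambda>\<omega>. Q (idx k \<omega>) \<omega> / p (idx k \<omega>)) = (\<Sum>i\<in>UNIV. expectation (Q i))"
proof -
  have "known (Suc k) (\<lambda>\<omega>. indicator {i} (idx k \<omega>) * (Q i \<omega> / p i))" for i
    by (intro known_compose2[where h = "\<lambda>j v. indicator {i} j * (v / p i)"] known_idx known_mono[OF Q]) simp
  then have int: "integrable P (\<lambda>\<omega>. indicator {i} (idx k \<omega>) * (Q i \<omega> / p i))" for i
    by (rule known_integrable)
  have "Q (idx k \<omega>) \<omega> / p (idx k \<omega>) = (\<Sum>i\<in>UNIV. indicator {i} (idx k \<omega>) * (Q i \<omega> / p i))" for \<omega>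
    by (subst sum.remove[of UNIV "idx k \<omega>"]) (auto simp: indicator_def intro!: sum.neutral)
  then have "expectation (\<lambda>\<omega>. Q (idx k \<omega>) \<omega> / p (idx k \<omega>))
      = (\<Sum>i\<in>UNIV. expectation (\<lambda>\<omega>. indicator {i} (idx k \<omega>) * (Q i \<omega> / p i)))"
    using int by (simp add: Bochner_Integration.integral_sum)
  also have "\<dots> = (\<Sum>i\<in>UNIV. expectation (Q i))"
  proof (rule sum.cong[OF refl])
    fix i
    have "known k (\<lambda>\<omega>. Q i \<omega> / p i)" by (rule known_compose[OF Q])
    from expectation_next_index[OF this, of i]
    show "expectation (\<lambda>\<omega>. indicator {i} (idx k \<omega>) * (Q i \<omega> / p i)) = expectation (Q i)"
      using p by simp
  qed
  finally show ?thesis .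
qed

end

section \<open>Two elementary estimates\<close>

text \<open>
  For fixed \<open>A\<close> and \<open>\<tau>\<close> the bound passes to the limit along \<open>K\<close>. The choice \<open>A = n\<close> and
  \<open>\<tau> = 1 / n\<^sup>2\<close> then makes both remaining terms of order \<open>1 / n\<close>.
\<close>

lemma limit_nonpos_of_tradeoff:
  fixes e z :: "nat \<Rightarrow> real"
  assumes e: "e \<longlonglongrightarrow> l" and z: "z \<longlonglongrightarrow> 0" and K: "infinite K"
    and bound: "\<And>k A \<tau>. k \<in> K \<Longrightarrow> 0 < A \<Longrightarrow> 0 < \<tau> \<Longrightarrow> \<tau> \<le> 1 \<Longrightarrow> e k \<le> A * (z k / \<tau> + b * \<tau>) + c / A"
  shows "l \<le> 0"
proof -
  obtain r :: "nat \<Rightarrow> nat" where r: "strict_mono r" "\<And>n. r n \<in> K" using infinite_enumerate[OF K] by blast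
  have er: "(\<lambda>n. e (r n)) \<longlonglongrightarrow> l" using LIMSEQ_subseq_LIMSEQ[OF e r(1)] by (simp add: comp_def)
  have zr: "(\<lambda>n. z (r n)) \<longlonglongrightarrow> 0" using LIMSEQ_subseq_LIMSEQ[OF z r(1)] by (simp add: comp_def)
  have lim: "l \<le> A * (b * \<tau>) + c / A" if "0 < A" "0 < \<tau>" "\<tau> \<le> 1" for A \<tau>
  proof (rule LIMSEQ_le[OF er])
    show "(\<lambda>n. A * (z (r n) / \<tau> + b * \<tau>) + c / A) \<longlonglongrightarrow> A * (b * \<tau>) + c / A"
      using that by (auto intro!: tendsto_eq_intros zr)
  qed (use bound[OF r(2) that] in auto)
  have "l \<le> (b + c) * inverse (real (Suc n))" for n
  proof -
    define N where "N = real (Suc n)"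
    have N: "N \<ge> 1" by (simp add: N_def)
    have "l \<le> N * (b * inverse (N * N)) + c / N"
      using N by (intro lim) (auto simp: field_simps mult_ge1_I)
    also have "\<dots> = (b + c) * inverse N" using N by (simp add: field_simps)
    finally show ?thesis by (simp add: N_def)
  qed
  moreover have "(\<lambda>n. (b + c) * inverse (real (Suc n))) \<longlonglongrightarrow> (b + c) * 0"
    by (intro tendsto_intros LIMSEQ_inverse_real_of_nat)
  ultimately show ?thesis using LIMSEQ_le_const by fastforce
qed

text \<open>
  The first summand dominates where \<open>1 + D \<le> A\<close>; elsewhere the second one exceeds the a priori
  bound \<open>C\<close>, as in Markov's inequality.
\<close>

lemma le_weighted_plus_tail:
  fixes u C D A :: real
  assumes "0 \<le> u" "u \<le> C" "0 \<le> D" "0 < A"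
  shows "u \<le> A * (u / (1 + D)) + C * (1 + D) / A"
proof (cases "1 + D \<le> A")
  case True
  then have "u * (1 + D) \<le> u * A" using assms by (intro mult_left_mono) auto
  then have "u \<le> A * (u / (1 + D))" using assms by (simp add: field_simps)
  moreover have "0 \<le> C * (1 + D) / A" using assms by auto
  ultimately show ?thesis by linarith
next
  case False
  then have "C * A \<le> C * (1 + D)" using assms by (intro mult_left_mono) auto
  then have "C \<le> C * (1 + D) / A" using assms by (simp add: field_simps)
  moreover have "0 \<le> A * (u / (1 + D))" using assms by auto
  ultimately show ?thesis using assms by linarith
qed

section \<open>Expected residuals of the random process\<close>

locale rnbpg = block_composite blk f gradf psi L + index_process P idx
  for blk :: "'n::finite \<Rightarrow> 'b::finite" and f gradf psi and L :: "'b \<Rightarrow> real"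
    and P :: "'w measure" and idx :: "nat \<Rightarrow> 'w \<Rightarrow> 'b" +
  fixes p :: "'b \<Rightarrow> real" and \<eta> \<sigma> \<theta>lo \<theta>hi :: real and m :: nat
    and x0 :: "real ^ 'n" and Xopt :: "(real ^ 'n) set"
    and \<theta>0 :: "nat \<Rightarrow> 'w \<Rightarrow> real" and x d :: "nat \<Rightarrow> 'w \<Rightarrow> real ^ 'n"
  assumes L_pos: "\<And>i. L i > 0"
    and x0_dom: "F x0 < \<infinity>"
    and params: "\<eta> > 1" "\<sigma> > 0" "0 < \<theta>lo"
    and p_pos: "\<And>i. 0 < p i"
    and idx_prob: "\<And>k i. prob {\<omega> \<in> space P. idx k \<omega> = i} = p i"
    and run: "\<And>\<omega>. \<omega> \<in> space P \<Longrightarrow> rnbpg_run blk f gradf psi \<eta> \<sigma> \<theta>lo \<theta>hi m x0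
        (\<lambda>k. idx k \<omega>) (\<lambda>k. \<theta>0 k \<omega>) (\<lambda>k. x k \<omega>) (\<lambda>k. d k \<omega>)"
    and d_known: "\<And>k. known (Suc k) (d k)"
    and Xopt_eq: "Xopt = opt_set F" and Xopt_nonempty: "Xopt \<noteq> {}"
    and unif_cont: "uniformly_continuous_on {y. F y \<le> F x0} obj"
begin

definition "Fopt = real_of_ereal (opt_value F)"
definition "residual k \<omega> = obj (x k \<omega>) - Fopt"
definition "progress k \<omega> = \<bar>obj (x k \<omega>) - obj (x (Suc k) \<omega>)\<bar> + (norm (d k \<omega>))\<^sup>2"

lemma Xopt_le: "y \<in> Xopt \<Longrightarrow> F y \<le> F z"
  by (auto simp: Xopt_eq opt_set_def is_arg_min_def not_less)

lemma Xopt_finite: "y \<in> Xopt \<Longrightarrow> F y < \<infinity>"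
  using Xopt_le x0_dom by (metis le_less_trans)

lemma Xopt_value: "y \<in> Xopt \<Longrightarrow> F y = ereal Fopt"
proof -
  assume y: "y \<in> Xopt"
  have "opt_value F = F y" unfolding opt_value_def
    using Xopt_le[OF y] by (intro antisym INF_lower INF_greatest) auto
  then show ?thesis using obj_eq[OF Xopt_finite[OF y]] by (simp add: Fopt_def)
qed

lemma Fopt_le: "F z < \<infinity> \<Longrightarrow> Fopt \<le> obj z"
  using Xopt_nonempty Xopt_le Xopt_value obj_eq by (metis all_not_in_conv ereal_less_eq(3))

lemmas x_Suc = run_step[OF run x0_dom params]
  and x_finite = run_finite[OF run x0_dom params]
  and x_descent = run_descent[OF run x0_dom params]
  and x_le_initial = run_le_initial[OF run x0_dom params]

lemma x_known: "known k (x k)"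
proof (induction k)
  case 0
  then show ?case using run by (auto simp: known_def rnbpg_run_def)
next
  case (Suc k)
  have "known (Suc k) (\<lambda>\<omega>. x k \<omega> + d k \<omega>)"
    by (rule known_compose2[OF known_mono[OF Suc] d_known]) simp
  then show ?case by (rule known_cong) (rule x_Suc)
qed

lemma residual_known: "known k (residual k)"
  unfolding residual_def by (rule known_compose[OF x_known])

lemma progress_known: "known (Suc k) (progress k)"
proof -
  have "known (Suc k) (\<lambda>\<omega>. \<bar>obj (x k \<omega>) - obj (x k \<omega> + d k \<omega>)\<bar> + (norm (d k \<omega>))\<^sup>2)"
    by (rule known_compose2[OF known_mono[OF x_known] d_known]) simp
  then show ?thesis by (rule known_cong) (simp add: progress_def x_Suc)
qed

lemma residual_bounds:
  assumes "\<omega> \<in> space P"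
  shows "0 \<le> residual k \<omega>" "residual k \<omega> \<le> obj x0 - Fopt"
  using Fopt_le[OF x_finite[OF assms]] x_le_initial[OF assms, of k] by (auto simp: residual_def)

lemma step_bound:
  assumes "\<omega> \<in> space P"
  shows "(norm (d k \<omega>))\<^sup>2 \<le> 2 / \<sigma> * (obj x0 - Fopt)"
proof -
  have "\<sigma> / 2 * (norm (d k \<omega>))\<^sup>2 \<le> obj x0 - Fopt"
    using x_descent[OF assms, of k] Fopt_le[OF x_finite[OF assms, of "Suc k"]]
      run_window_le[OF run[OF assms] x0_dom params, of k] by linarith
  then show ?thesis using params by (simp add: field_simps)
qed

lemma progress_bounds:
  assumes "\<omega> \<in> space P"
  shows "0 \<le> progress k \<omega>" "progress k \<omega> \<le> (1 + 2 / \<sigma>) * (obj x0 - Fopt)"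
proof -
  show "0 \<le> progress k \<omega>" by (simp add: progress_def)
  have "\<bar>obj (x k \<omega>) - obj (x (Suc k) \<omega>)\<bar> \<le> obj x0 - Fopt"
    using residual_bounds[OF assms, of k] residual_bounds[OF assms, of "Suc k"]
    by (simp add: residual_def)
  then show "progress k \<omega> \<le> (1 + 2 / \<sigma>) * (obj x0 - Fopt)"
    using step_bound[OF assms, of k] by (simp add: progress_def distrib_right)
qed

text \<open>
  The deterministic descent lemma applies to each realization separately. The rate may depend on
  the realization, so that passing to the means takes dominated convergence.
\<close>

lemma pathwise_limits:
  assumes "\<omega> \<in> space P"
  shows "convergent (\<lambda>k. residual k \<omega>)" "(\<lambda>k. progress k \<omega>) \<longlonglongrightarrow> 0"
proof -
  have S: "x k \<omega> \<in> {y. F y \<le> F x0}" for k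
    using x_le_initial[OF assms, of k] obj_eq[OF x_finite[OF assms, of k]] obj_eq[OF x0_dom]
    by (metis ereal_less_eq(3) mem_Collect_eq)
  have d: "x (Suc k) \<omega> - x k \<omega> = d k \<omega>" for k by (simp add: x_Suc[OF assms])
  note lim = nonmonotone_descent_converges[where x = "\<lambda>k. x k \<omega>" and c = "\<sigma> / 2" and B = Fopt and m = m, OF unif_cont S,
      unfolded d, OF _ x_descent[OF assms] Fopt_le[OF x_finite[OF assms]]]
  have conv: "convergent (\<lambda>k. obj (x k \<omega>))" and steps: "(\<lambda>k. norm (d k \<omega>)) \<longlonglongrightarrow> 0"
    using lim params by auto
  then obtain v where v: "(\<lambda>k. obj (x k \<omega>)) \<longlonglongrightarrow> v" by (auto simp: convergent_def)
  show "convergent (\<lambda>k. residual k \<omega>)"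
    unfolding residual_def convergent_def using tendsto_diff[OF v tendsto_const] by blast
  have "(\<lambda>k. \<bar>obj (x k \<omega>) - obj (x (Suc k) \<omega>)\<bar> + (norm (d k \<omega>))\<^sup>2) \<longlonglongrightarrow> \<bar>v - v\<bar> + 0\<^sup>2"
    by (intro tendsto_intros v steps LIMSEQ_Suc[OF v])
  then show "(\<lambda>k. progress k \<omega>) \<longlonglongrightarrow> 0" by (simp add: progress_def)
qed

lemma expectation_residual_convergent: "convergent (\<lambda>k. expectation (residual k))"
proof -
  have meas: "residual k \<in> borel_measurable P" for k
    using known_integrable[OF residual_known] by auto
  have "(\<lambda>k. expectation (residual k)) \<longlonglongrightarrow> expectation (\<lambda>\<omega>. lim (\<lambda>k. residual k \<omega>))"
  proof (rule integral_dominated_convergence[where w = "\<lambda>_. obj x0 - Fopt"])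
    show "AE \<omega> in P. (\<lambda>k. residual k \<omega>) \<longlonglongrightarrow> lim (\<lambda>k. residual k \<omega>)"
      using pathwise_limits(1) by (intro AE_I2) (simp add: convergent_LIMSEQ_iff)
    show "AE \<omega> in P. norm (residual k \<omega>) \<le> obj x0 - Fopt" for k
      using residual_bounds by (intro AE_I2) simp
  qed (use meas in auto)
  then show ?thesis by (auto simp: convergent_def)
qed

lemma expectation_progress_tendsto_zero: "(\<lambda>k. expectation (progress k)) \<longlonglongrightarrow> 0"
proof -
  have meas: "progress k \<in> borel_measurable P" for k
    using known_integrable[OF progress_known] by auto
  have "(\<lambda>k. expectation (progress k)) \<longlonglongrightarrow> expectation (\<lambda>\<omega>. 0)"
  proof (rule integral_dominated_convergence[where w = "\<lambda>_. (1 + 2 / \<sigma>) * (obj x0 - Fopt)"])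
    show "AE \<omega> in P. (\<lambda>k. progress k \<omega>) \<longlonglongrightarrow> 0"
      using pathwise_limits(2) by (intro AE_I2) simp
    show "AE \<omega> in P. norm (progress k \<omega>) \<le> (1 + 2 / \<sigma>) * (obj x0 - Fopt)" for k
      using progress_bounds by (intro AE_I2) simp
  qed (use meas in auto)
  then show ?thesis by simp
qed

text \<open>
  \<open>\<Theta>\<close> bounds all accepted proximal parameters, whichever block is drawn; \<open>\<kappa>\<close> bounds the constants
  that arise when the progress is divided by the probability of the drawn block.
\<close>

definition "\<Theta> = max \<theta>hi (\<eta> * ((\<Sum>i\<in>UNIV. L i) + \<sigma>))"
definition "\<kappa> = (\<Sum>i\<in>UNIV. (1 + L i) / p i)"

text \<open>
  An almost nearest optimal point. The slack of \<open>1\<close> ensures existence, the distance being an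
  infimum, and matches the weight \<open>1 + infdist y Xopt\<close> used below.
\<close>

definition near_opt :: "real ^ 'n \<Rightarrow> real ^ 'n" where
  "near_opt y = (SOME z. z \<in> Xopt \<and> norm (z - y) \<le> 1 + infdist y Xopt)"

lemma near_opt: "near_opt y \<in> Xopt" "norm (near_opt y - y) \<le> 1 + infdist y Xopt"
proof -
  have "(INF z\<in>Xopt. dist y z) < 1 + infdist y Xopt" using Xopt_nonempty by (simp add: infdist_def)
  then obtain z where "z \<in> Xopt" "dist y z < 1 + infdist y Xopt"
    using Xopt_nonempty by (subst (asm) cINF_less_iff) auto
  then have "z \<in> Xopt \<and> norm (z - y) \<le> 1 + infdist y Xopt" by (simp add: dist_norm norm_minus_commute)
  then have "near_opt y \<in> Xopt \<and> norm (near_opt y - y) \<le> 1 + infdist y Xopt"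
    unfolding near_opt_def by (rule someI)
  then show "near_opt y \<in> Xopt" "norm (near_opt y - y) \<le> 1 + infdist y Xopt" by auto
qed

text \<open>The bound of \<open>prox_step_gap\<close> at \<open>y\<close>, with an almost nearest optimal point as competitor.\<close>

definition block_gap :: "real \<Rightarrow> 'b \<Rightarrow> real ^ 'n \<Rightarrow> real" where
  "block_gap t i y = t * (block blk i (gradf y) \<bullet> (near_opt y - y)
      + block_psi i (near_opt y) - block_psi i y)
    + \<Theta> / 2 * t\<^sup>2 * (norm (block blk i (near_opt y - y)))\<^sup>2"

lemma progress_ge_block_gap:
  assumes \<omega>: "\<omega> \<in> space P" and t: "0 \<le> t" "t \<le> 1"
  shows "- (\<kappa> * progress k \<omega>) \<le> block_gap t (idx k \<omega>) (x k \<omega>) / p (idx k \<omega>)"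
proof -
  define i where "i = idx k \<omega>"
  obtain \<theta> where \<theta>: "is_prox_step blk gradf psi i (x k \<omega>) \<theta> (d k \<omega>)" "0 \<le> \<theta>"
    "\<theta> \<le> max \<theta>hi (\<eta> * (L i + \<sigma>))"
    using run_prox_step[OF run[OF \<omega>] x0_dom params, of k] unfolding i_def by blast
  have "L i \<le> (\<Sum>i\<in>UNIV. L i)" using L_pos by (intro member_le_sum) (auto simp: less_imp_le)
  then have "max \<theta>hi (\<eta> * (L i + \<sigma>)) \<le> \<Theta>" unfolding \<Theta>_def using params by (intro max.mono) auto
  with \<theta> have "obj (x k \<omega> + d k \<omega>) - obj (x k \<omega>) - L i / 2 * (norm (d k \<omega>))\<^sup>2 \<le> block_gap t i (x k \<omega>)"
    unfolding block_gap_def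
    by (intro prox_step_gap[OF \<theta>(1,2) _ x_finite[OF \<omega>] Xopt_finite[OF near_opt(1)] t]) auto
  moreover have "obj (x k \<omega>) - obj (x (Suc k) \<omega>) + L i / 2 * (norm (d k \<omega>))\<^sup>2 \<le> (1 + L i) * progress k \<omega>"
  proof -
    have "L i / 2 * (norm (d k \<omega>))\<^sup>2 \<le> L i * progress k \<omega>"
      using L_pos[of i] by (intro mult_mono) (auto simp: progress_def less_imp_le)
    moreover have "obj (x k \<omega>) - obj (x (Suc k) \<omega>) \<le> progress k \<omega>"
      unfolding progress_def using zero_le_power2[of "norm (d k \<omega>)"] by linarith
    ultimately show ?thesis by (simp add: distrib_right)
  qed
  ultimately have "- ((1 + L i) * progress k \<omega>) \<le> block_gap t i (x k \<omega>)"
    by (simp add: x_Suc[OF \<omega>])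
  then have "- ((1 + L i) * progress k \<omega>) / p i \<le> block_gap t i (x k \<omega>) / p i"
    using p_pos[of i] by (intro divide_right_mono) auto
  moreover have "(1 + L i) / p i \<le> \<kappa>"
    unfolding \<kappa>_def using L_pos p_pos
    by (intro member_le_sum) (auto intro!: divide_nonneg_nonneg add_nonneg_nonneg simp: less_imp_le)
  then have "(1 + L i) / p i * progress k \<omega> \<le> \<kappa> * progress k \<omega>"
    by (intro mult_right_mono progress_bounds(1)[OF \<omega>])
  ultimately show ?thesis by (simp add: i_def)
qed

lemma sum_block_gap_le:
  assumes y: "F y < \<infinity>" and \<tau>: "0 \<le> \<tau>"
  shows "(\<Sum>i\<in>UNIV. block_gap (\<tau> / (1 + infdist y Xopt)) i y)
    \<le> \<Theta> / 2 * \<tau>\<^sup>2 - \<tau> * ((obj y - Fopt) / (1 + infdist y Xopt))"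
proof -
  define D where "D = infdist y Xopt"
  have D: "0 \<le> D" by (simp add: D_def infdist_nonneg)
  have "obj (near_opt y) = Fopt" using Xopt_value[OF near_opt(1)] by simp
  then have "(\<Sum>i\<in>UNIV. block_gap (\<tau> / (1 + D)) i y)
      \<le> \<Theta> / 2 * (\<tau> / (1 + D))\<^sup>2 * (norm (near_opt y - y))\<^sup>2 - \<tau> / (1 + D) * (obj y - Fopt)"
    unfolding block_gap_def
    using sum_gap[OF y Xopt_finite[OF near_opt(1)[of y]], of "\<tau> / (1 + D)", where c = "\<Theta> / 2 * (\<tau> / (1 + D))\<^sup>2"] \<tau> D
    by simp
  also have "\<Theta> / 2 * (\<tau> / (1 + D))\<^sup>2 * (norm (near_opt y - y))\<^sup>2 \<le> \<Theta> / 2 * (\<tau> / (1 + D))\<^sup>2 * (1 + D)\<^sup>2"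
  proof (intro mult_left_mono power_mono)
    have "0 \<le> (\<Sum>i\<in>UNIV. L i)" using L_pos by (intro sum_nonneg) (auto simp: less_imp_le)
    then have "0 \<le> \<Theta>" unfolding \<Theta>_def using params by (auto simp: le_max_iff_disj)
    then show "0 \<le> \<Theta> / 2 * (\<tau> / (1 + D))\<^sup>2" by simp
  qed (use near_opt(2)[of y] in \<open>auto simp: D_def\<close>)
  also have "\<Theta> / 2 * (\<tau> / (1 + D))\<^sup>2 * (1 + D)\<^sup>2 = \<Theta> / 2 * \<tau>\<^sup>2"
    using D by (simp add: power_divide)
  finally show ?thesis by (simp add: D_def)
qed

text \<open>
  With \<open>t = \<tau> / (1 + infdist y Xopt)\<close> the term \<open>t\<^sup>2 * (norm (near_opt y - y))\<^sup>2\<close> is at most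
  \<open>\<tau>\<^sup>2\<close>, so no second moment of the distance enters.
\<close>

lemma expectation_weighted_residual:
  assumes \<tau>: "0 < \<tau>" "\<tau> \<le> 1"
  shows "expectation (\<lambda>\<omega>. residual k \<omega> / (1 + infdist (x k \<omega>) Xopt))
    \<le> \<kappa> * expectation (progress k) / \<tau> + \<Theta> / 2 * \<tau>"
proof -
  define t where "t y = \<tau> / (1 + infdist y Xopt)" for y
  have t: "0 \<le> t y" "t y \<le> 1" for y
    using \<tau> infdist_nonneg[of y Xopt] by (auto simp: t_def field_simps)
  define Q where "Q i \<omega> = block_gap (t (x k \<omega>)) i (x k \<omega>)" for i \<omega>
  define r where "r \<omega> = residual k \<omega> / (1 + infdist (x k \<omega>) Xopt)" for \<omega>
  have Q: "known k (Q i)" for i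
    unfolding Q_def by (rule known_compose[OF x_known])
  have "known (Suc k) (\<lambda>\<omega>. block_gap (t (x k \<omega>)) (idx k \<omega>) (x k \<omega>) / p (idx k \<omega>))"
    by (rule known_compose2[OF known_mono[OF x_known] known_idx,
          where h = "\<lambda>y i. block_gap (t y) i y / p i"]) simp
  then have int: "integrable P (\<lambda>\<omega>. Q (idx k \<omega>) \<omega> / p (idx k \<omega>))"
    unfolding Q_def by (rule known_integrable)
  have "known k (\<lambda>\<omega>. (obj (x k \<omega>) - Fopt) / (1 + infdist (x k \<omega>) Xopt))"
    by (rule known_compose[OF x_known])
  then have r: "integrable P r"
    unfolding r_def residual_def by (rule known_integrable)
  have "- (\<kappa> * expectation (progress k)) = expectation (\<lambda>\<omega>. - (\<kappa> * progress k \<omega>))" by simp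
  also have "\<dots> \<le> expectation (\<lambda>\<omega>. Q (idx k \<omega>) \<omega> / p (idx k \<omega>))"
    using int known_integrable[OF progress_known[of k]] progress_ge_block_gap t
    by (intro integral_mono) (auto simp: Q_def)
  also have "\<dots> = (\<Sum>i\<in>UNIV. expectation (Q i))"
    using p_pos by (intro expectation_importance_weighted Q idx_prob) (simp add: less_imp_neq[symmetric])
  also have "\<dots> = expectation (\<lambda>\<omega>. \<Sum>i\<in>UNIV. Q i \<omega>)"
    using known_integrable[OF Q] by (simp add: Bochner_Integration.integral_sum)
  also have "\<dots> \<le> expectation (\<lambda>\<omega>. \<Theta> / 2 * \<tau>\<^sup>2 - \<tau> * r \<omega>)"
  proof (rule integral_mono)
    show "(\<Sum>i\<in>UNIV. Q i \<omega>) \<le> \<Theta> / 2 * \<tau>\<^sup>2 - \<tau> * r \<omega>" if "\<omega> \<in> space P" for \<omega>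
      using sum_block_gap_le[OF x_finite[OF that], of \<tau> k] \<tau> by (simp add: Q_def t_def r_def residual_def)
  qed (use r known_integrable[OF Q] in auto)
  also have "\<dots> = \<Theta> / 2 * \<tau>\<^sup>2 - \<tau> * expectation r"
    using r by (simp add: prob_space)
  finally have "\<tau> * expectation r \<le> \<tau> * (\<kappa> * expectation (progress k) / \<tau> + \<Theta> / 2 * \<tau>)"
    using \<tau> by (simp add: distrib_left power2_eq_square mult_ac)
  then have "expectation r \<le> \<kappa> * expectation (progress k) / \<tau> + \<Theta> / 2 * \<tau>"
    using \<tau> by simp
  then show ?thesis unfolding r_def .
qed

lemma expectation_residual_le:
  assumes A: "0 < A" and \<tau>: "0 < \<tau>" "\<tau> \<le> 1"
  shows "expectation (residual k) \<le> A * (\<kappa> * expectation (progress k) / \<tau> + \<Theta> / 2 * \<tau>)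
    + (obj x0 - Fopt) * (1 + expectation (\<lambda>\<omega>. infdist (x k \<omega>) Xopt)) / A"
proof -
  define C where "C = obj x0 - Fopt"
  define D where "D \<omega> = infdist (x k \<omega>) Xopt" for \<omega>
  define r where "r \<omega> = residual k \<omega> / (1 + D \<omega>)" for \<omega>
  have "known k D" unfolding D_def by (rule known_compose[OF x_known])
  moreover from this have "known k r" unfolding r_def by (rule known_compose2[OF residual_known])
  ultimately have int: "integrable P (residual k)" "integrable P D" "integrable P r"
    using residual_known by (auto intro: known_integrable)
  then have "integrable P (\<lambda>\<omega>. A * r \<omega> + C * (1 + D \<omega>) / A)" by simp
  then have "expectation (residual k) \<le> expectation (\<lambda>\<omega>. A * r \<omega> + C * (1 + D \<omega>) / A)"
    unfolding r_def
    by (intro integral_mono[OF int(1)] le_weighted_plus_tail)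
      (simp_all add: C_def D_def A residual_bounds infdist_nonneg)
  also have "\<dots> = A * expectation r + C * (1 + expectation D) / A"
    using int by (simp add: prob_space)
  also have "\<dots> \<le> A * (\<kappa> * expectation (progress k) / \<tau> + \<Theta> / 2 * \<tau>) + C * (1 + expectation D) / A"
    unfolding r_def D_def
    using A by (intro add_right_mono mult_left_mono expectation_weighted_residual \<tau>) auto
  finally show ?thesis unfolding C_def D_def[abs_def] .
qed

text \<open>
  The mean residuals converge anyway, so it is enough to identify their limit along the
  subsequence on which the mean distance is bounded.
\<close>

lemma expectation_residual_tendsto_zero:
  assumes K: "infinite K" and bdd: "bounded ((\<lambda>k. expectation (\<lambda>\<omega>. infdist (x k \<omega>) Xopt)) ` K)"
  shows "(\<lambda>k. expectation (residual k)) \<longlonglongrightarrow> 0"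
proof -
  obtain l where l: "(\<lambda>k. expectation (residual k)) \<longlonglongrightarrow> l"
    using expectation_residual_convergent by (auto simp: convergent_def)
  obtain R where R: "\<And>k. k \<in> K \<Longrightarrow> expectation (\<lambda>\<omega>. infdist (x k \<omega>) Xopt) \<le> R"
    using bounded_imp_bdd_above[OF bdd] by (auto simp: bdd_above_def)
  have C: "0 \<le> obj x0 - Fopt" using Fopt_le[OF x0_dom] by simp
  have "l \<le> 0"
  proof (rule limit_nonpos_of_tradeoff[OF l _ K])
    show "(\<lambda>k. \<kappa> * expectation (progress k)) \<longlonglongrightarrow> 0"
      using tendsto_mult_right_zero[OF expectation_progress_tendsto_zero] .
    fix k A \<tau> :: real assume "0 < A"
  next
    fix k A \<tau> assume k: "k \<in> K" and A: "(0::real) < A" and \<tau>: "0 < \<tau>" "\<tau> \<le> (1::real)"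
    have "(obj x0 - Fopt) * (1 + expectation (\<lambda>\<omega>. infdist (x k \<omega>) Xopt)) / A
        \<le> (obj x0 - Fopt) * (1 + R) / A"
      using A C R[OF k] by (intro divide_right_mono mult_left_mono) auto
    then show "expectation (residual k) \<le> A * (\<kappa> * expectation (progress k) / \<tau> + \<Theta> / 2 * \<tau>)
        + (obj x0 - Fopt) * (1 + R) / A"
      using expectation_residual_le[OF A \<tau>, of k] by linarith
  qed
  moreover have "0 \<le> l"
    using residual_bounds(1) by (intro LIMSEQ_le_const[OF l] exI allI impI integral_nonneg_AE AE_I2) auto
  ultimately show ?thesis using l by simp
qed

end

theorem theorem3p1:
  fixes blk :: "'n::finite \<Rightarrow> 'b::finite"
    and f :: "real ^ 'n \<Rightarrow> real" and gradf :: "real ^ 'n \<Rightarrow> real ^ 'n"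
    and psi :: "'b \<Rightarrow> real ^ 'n \<Rightarrow> ereal"
    and F :: "real ^ 'n \<Rightarrow> ereal"
    and L p :: "'b \<Rightarrow> real"
    and \<eta> \<sigma> \<theta>lo \<theta>hi Fstar :: real and m :: nat
    and x0 :: "real ^ 'n" and Xstar S :: "(real ^ 'n) set"
    and P :: "'w measure" and idx :: "nat \<Rightarrow> 'w \<Rightarrow> 'b" and \<theta>0 :: "nat \<Rightarrow> 'w \<Rightarrow> real"
    and x d :: "nat \<Rightarrow> 'w \<Rightarrow> real ^ 'n"
    and KK :: "nat set"
  assumes F_eq: "F = composite blk f psi"
    and Xstar_eq: "Xstar = opt_set F"
    and Fstar_eq: "Fstar = real_of_ereal (opt_value F)"
    and S_eq: "S = {y. F y \<le> F x0 + ereal (max (real CARD('b) / \<sigma> * \<bar>(\<Sum>i\<in>UNIV. L i) - \<theta>lo\<bar>) 1)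
                                   * (F x0 - ereal Fstar)}"
    and grad: "\<And>y. GDERIV f y :> gradf y"
    and L_pos: "\<And>i. L i > 0"
    and lipschitz: "\<And>i y h. h \<in> block_space blk i \<Longrightarrow>
          norm (block blk i (gradf (y + h)) - block blk i (gradf y)) \<le> L i * norm h"
    and psi_not_MInf: "\<And>i s. s \<in> block_space blk i \<Longrightarrow> psi i s \<noteq> -\<infinity>"
    and Xstar_nonempty: "Xstar \<noteq> {}"
    and f_convex: "convex_on UNIV f"
    and psi_convex: "convex_ereal (sepfun blk psi)"
    and x0_dom: "F x0 < \<infinity>"
    and params: "\<eta> > 1" "\<sigma> > 0" "0 < \<theta>lo" "\<theta>lo \<le> \<theta>hi"
    and p_range: "\<And>i. 0 < p i \<and> p i < 1"
    and p_sum: "(\<Sum>i\<in>UNIV. p i) = 1"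
    and process: "rnbpg_process blk f gradf psi \<eta> \<sigma> \<theta>lo \<theta>hi m x0 p P idx \<theta>0 x d"
    and unif_cont: "uniformly_continuous_on S (\<lambda>y. real_of_ereal (F y))"
    and KK_infinite: "infinite KK"
    and dist_bounded: "bounded ((\<lambda>k. \<integral>\<omega>. infdist (x k \<omega>) Xstar \<partial>P) ` KK)"
  shows "((\<lambda>k. \<integral>\<omega>. real_of_ereal (F (x k \<omega>)) \<partial>P) \<longlonglongrightarrow> Fstar) \<and>
    (\<forall>\<epsilon>>0. \<forall>\<rho>\<in>{0<..<1}. \<exists>K. \<forall>k\<ge>K.
           measure P {\<omega> \<in> space P. F (x k \<omega>) - ereal Fstar \<le> ereal \<epsilon>} \<ge> 1 - \<rho>)"
proof -
  have proc: "prob_space P"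
    "prob_space.indep_vars P (\<lambda>_. count_space UNIV) idx UNIV"
    "\<And>k i. measure P {\<omega> \<in> space P. idx k \<omega> = i} = p i"
    "\<And>\<omega>. \<omega> \<in> space P \<Longrightarrow> rnbpg_run blk f gradf psi \<eta> \<sigma> \<theta>lo \<theta>hi m x0
        (\<lambda>k. idx k \<omega>) (\<lambda>k. \<theta>0 k \<omega>) (\<lambda>k. x k \<omega>) (\<lambda>k. d k \<omega>)"
    "\<And>k \<omega> \<omega>'. \<omega> \<in> space P \<Longrightarrow> \<omega>' \<in> space P \<Longrightarrow> \<forall>l\<le>k. idx l \<omega> = idx l \<omega>' \<Longrightarrow> d k \<omega> = d k \<omega>'"
    using process unfolding rnbpg_process_def by blast+
  interpret prob_space P by (rule proc(1))
  interpret index_process P idx by unfold_locales (rule proc(2))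
  interpret block_composite blk f gradf psi L
    by unfold_locales (fact grad lipschitz psi_not_MInf f_convex psi_convex)+
  obtain xs where xs: "xs \<in> Xstar" using Xstar_nonempty by blast
  have xs_le: "F xs \<le> F z" for z
    using xs by (auto simp: Xstar_eq opt_set_def is_arg_min_def not_less)
  have "opt_value F = F xs" unfolding opt_value_def
    by (intro antisym INF_lower INF_greatest xs_le) simp
  moreover have "F xs < \<infinity>" using xs_le x0_dom by (rule le_less_trans)
  ultimately have "F xs = ereal Fstar" using obj_eq by (simp add: F_eq Fstar_eq)
  then have "0 \<le> F x0 - ereal Fstar"
    using xs_le[of x0] by (cases "F x0") auto
  \<comment> \<open>Since \<open>F x0 - Fstar\<close> is nonnegative, the enlarged set \<open>S\<close> contains the level set of \<open>x0\<close>,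
    to which all iterates belong.\<close>
  then have "F x0 + 0 \<le> F x0 + ereal (max (real CARD('b) / \<sigma> * \<bar>(\<Sum>i\<in>UNIV. L i) - \<theta>lo\<bar>) 1)
      * (F x0 - ereal Fstar)"
    by (intro add_left_mono ereal_0_le_mult) (simp_all add: le_max_iff_disj)
  then have "F x0 \<le> F x0 + ereal (max (real CARD('b) / \<sigma> * \<bar>(\<Sum>i\<in>UNIV. L i) - \<theta>lo\<bar>) 1)
      * (F x0 - ereal Fstar)"
    by (simp only: add_0_right)
  then have "{y. F y \<le> F x0} \<subseteq> S"
    unfolding S_eq by (intro Collect_mono impI) (erule order_trans)
  then have uc: "uniformly_continuous_on {y. F y \<le> F x0} (\<lambda>y. real_of_ereal (F y))"
    by (rule uniformly_continuous_on_restrict[OF unif_cont])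
  interpret rnbpg blk f gradf psi L P idx p \<eta> \<sigma> \<theta>lo \<theta>hi m x0 Xstar \<theta>0 x d
  proof unfold_locales
    show "known (Suc k) (d k)" for k
      unfolding known_def less_Suc_eq_le by (intro ballI impI) (rule proc(5))
  qed (fact L_pos x0_dom[unfolded F_eq] params(1-3) conjunct1[OF p_range] proc(3,4)
      Xstar_eq[unfolded F_eq] Xstar_nonempty uc[unfolded F_eq])+
  have Fopt: "Fopt = Fstar" by (simp add: Fopt_def Fstar_eq F_eq)
  have lim: "(\<lambda>k. expectation (residual k)) \<longlonglongrightarrow> 0"
    by (rule expectation_residual_tendsto_zero[OF KK_infinite dist_bounded])
  have res: "integrable P (residual k)" for k by (rule known_integrable[OF residual_known])
  have "expectation (\<lambda>\<omega>. real_of_ereal (F (x k \<omega>))) = expectation (\<lambda>\<omega>. residual k \<omega> + Fstar)" for k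
    by (simp add: residual_def Fopt F_eq)
  then have "expectation (\<lambda>\<omega>. real_of_ereal (F (x k \<omega>))) = expectation (residual k) + Fstar" for k
    using res by (simp add: prob_space)
  then have mean: "(\<lambda>k. expectation (\<lambda>\<omega>. real_of_ereal (F (x k \<omega>)))) \<longlonglongrightarrow> Fstar"
    using tendsto_add[OF lim tendsto_const[of Fstar]] by simp
  have "\<exists>K. \<forall>k\<ge>K. prob {\<omega> \<in> space P. F (x k \<omega>) - ereal Fstar \<le> ereal \<epsilon>} \<ge> 1 - \<rho>"
    if \<epsilon>: "\<epsilon> > 0" and \<rho>: "\<rho> > 0" for \<epsilon> \<rho> :: real
  proof -
    have "\<forall>\<^sub>F k in sequentially. expectation (residual k) < \<epsilon> * \<rho>"
      using lim \<epsilon> \<rho> by (intro order_tendstoD) auto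
    moreover have "prob {\<omega> \<in> space P. F (x k \<omega>) - ereal Fstar \<le> ereal \<epsilon>} \<ge> 1 - \<rho>"
      if k: "expectation (residual k) < \<epsilon> * \<rho>" for k
    proof -
      have [measurable]: "residual k \<in> borel_measurable P" using res by auto
      have "{\<omega> \<in> space P. F (x k \<omega>) - ereal Fstar \<le> ereal \<epsilon>} = {\<omega> \<in> space P. residual k \<omega> \<le> \<epsilon>}"
      proof (intro Collect_cong conj_cong refl)
        fix \<omega> assume "\<omega> \<in> space P"
        from obj_eq[OF x_finite[OF this, of k]]
        have "F (x k \<omega>) = ereal (residual k \<omega> + Fstar)" by (simp add: residual_def Fopt F_eq)
        then show "F (x k \<omega>) - ereal Fstar \<le> ereal \<epsilon> \<longleftrightarrow> residual k \<omega> \<le> \<epsilon>" by simp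
      qed
      also have "prob \<dots> = 1 - prob {\<omega> \<in> space P. \<not> residual k \<omega> \<le> \<epsilon>}"
        by (subst prob_neg) auto
      finally have eq: "prob {\<omega> \<in> space P. F (x k \<omega>) - ereal Fstar \<le> ereal \<epsilon>}
          = 1 - prob {\<omega> \<in> space P. \<not> residual k \<omega> \<le> \<epsilon>}" .
      have "prob {\<omega> \<in> space P. \<not> residual k \<omega> \<le> \<epsilon>} \<le> prob {\<omega> \<in> space P. \<epsilon> \<le> residual k \<omega>}"
        by (intro finite_measure_mono) auto
      also have "\<dots> \<le> expectation (residual k) / \<epsilon>"
        by (rule integral_Markov_inequality_measure[OF res sets.empty_sets])
          (use residual_bounds(1) \<epsilon> in auto)
      also have "\<dots> \<le> \<rho>" using k \<epsilon> by (simp add: field_simps)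
      finally show ?thesis using eq by linarith
    qed
    ultimately show ?thesis unfolding eventually_sequentially by blast
  qed
  with mean show ?thesis by auto
qed

end
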